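(* Fix positive integers $t\leqslant m\leqslant n$, and let $X=(x_{ij})$ be an $m\times n$ matrix of indeterminates over a field $\mathbb{F}$ of prime characteristic $p$. Let $R=\mathbb{F}[X]$ and let $I_t\subseteq R$ be the ideal generated by the $t\times t$ minors of $X$. Then \[ \operatorname{fpt}(I_t)=\min\left\{\frac{(m-k)(n-k)}{t-k}\;\middle|\; k=0,1,\dots,t-1\right\}. \] In particular, $\operatorname{fpt}(I_t)$ does not depend on the characteristic $p$.
   Context: Let $R$ be a polynomial ring over a field of characteristic $p>0$ with homogeneous maximal ideal $\mathfrak{m}$. For $q=p^e$, $\mathfrak{m}^{[q]}$ denotes the ideal generated by $\{a^q : a\in\mathfrak{m}\}$ (equivalently, by the $q$-th powers of the variables). For a homogeneous proper ideal $I$ and $q=p^e$, set $\nu_I(q)=\max\{r\in\mathbb{N} : I^r\not\subseteq \mathfrak{m}^{[q]}\}$. The sequence $\nu_I(p^e)/p^e$ is bounded and nondecreasing, and its limit is the $F$-pure threshold $\operatorname{fpt}(I)$. *)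

theory Defs
  imports "HOL-Analysis.Analysis" "HOL-Library.Poly_Mapping" "HOL-Combinatorics.Permutations"
begin

text \<open>Polynomial ring over 'a in the indeterminates x_(i,j), (i,j) :: nat \<times> nat.
  Monomials are finitely supported exponent vectors; polynomials are finitely
  supported coefficient functions on monomials (convolution product).\<close>
type_synonym 'a mpoly = "((nat \<times> nat) \<Rightarrow>\<^sub>0 nat) \<Rightarrow>\<^sub>0 'a"

definition var :: "nat \<Rightarrow> nat \<Rightarrow> 'a::comm_ring_1 mpoly" where
  "var i j = Poly_Mapping.single (Poly_Mapping.single (i, j) 1) 1"

definition gen_ideal :: "'b::comm_ring_1 set \<Rightarrow> 'b set" where
  "gen_ideal S = {\<Sum>s\<in>F. c s * s | F c. finite F \<and> F \<subseteq> S}"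

definition ideal_pow :: "'b::comm_ring_1 set \<Rightarrow> nat \<Rightarrow> 'b set" where
  "ideal_pow I r = gen_ideal {prod_list xs | xs. length xs = r \<and> set xs \<subseteq> I}"

definition frob_pow :: "'b::comm_ring_1 set \<Rightarrow> nat \<Rightarrow> 'b set" where
  "frob_pow I q = gen_ideal {a ^ q | a. a \<in> I}"

definition max_ideal :: "nat \<Rightarrow> nat \<Rightarrow> 'a::comm_ring_1 mpoly set" where
  "max_ideal m n = gen_ideal {var i j | i j. i < m \<and> j < n}"

definition minor :: "nat \<Rightarrow> (nat \<Rightarrow> nat) \<Rightarrow> (nat \<Rightarrow> nat) \<Rightarrow> 'a::comm_ring_1 mpoly" where
  "minor t rs cs = (\<Sum>\<sigma> | \<sigma> permutes {..<t}.
      of_int (sign \<sigma>) * (\<Prod>k<t. var (rs k) (cs (\<sigma> k))))"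

definition minors_ideal :: "nat \<Rightarrow> nat \<Rightarrow> nat \<Rightarrow> 'a::comm_ring_1 mpoly set" where
  "minors_ideal m n t = gen_ideal {minor t rs cs | rs cs.
      strict_mono_on {..<t} rs \<and> rs ` {..<t} \<subseteq> {..<m} \<and>
      strict_mono_on {..<t} cs \<and> cs ` {..<t} \<subseteq> {..<n}}"

definition nu :: "nat \<Rightarrow> nat \<Rightarrow> 'a::comm_ring_1 mpoly set \<Rightarrow> nat \<Rightarrow> nat" where
  "nu m n I q = (GREATEST r. \<not> ideal_pow I r \<subseteq> frob_pow (max_ideal m n) q)"

end

(*
  Write I_a for the ideal of a-minors.

  Lower bound. Say that L is asymptotically contained in J if L^(l + h) lies in J^l for some
  fixed h and all l. By a Laplace exchange relation every product of an a-minor and a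
  (b + 1)-minor with a <= b satisfies a quadratic integral equation over the products whose row
  sets are closer to being nested, and lies in I_(a+1) I_b if the row sets are nested. Hence
  I_a I_(b+1) is asymptotically contained in I_(a+1) I_b. Balancing the sizes of the minors along
  all diagonals of X in this way, the N-th power of their product Delta is asymptotically in I_t^s
  as soon as s (t - k) <= N (m - k)(n - k) for all k < t. The leading monomial of Delta is the
  product of all indeterminates, so Delta^(q - 1) is not in m^[q].

  Upper bound. After adding s to the first k diagonal entries, the leading k-minor delta
  satisfies delta^q = s^(kq) modulo m^[q], and up to a power of delta each t-minor lies in the
  (t - k)-th power of the ideal generated by the (m - k)(n - k) entries of a Schur complement.
  By the pigeonhole principle a product of r minors with (t - k) r > (m - k)(n - k)(q - 1) lies,
  up to a power of s, in m^[q]; cancel that power and put s = 0.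
*)
theory Submission
  imports Defs "Jordan_Normal_Form.Determinant"
begin

section \<open>Powers of ideals and asymptotic containment\<close>

text \<open>The exchange relations do not put a product of minors into I_(a+1) I_b; they only give
  quadratic equations of integral dependence, valid in every characteristic. Hence a bounded loss h
  in the exponent is tolerated throughout: it survives products, finite unions and composition, and
  it disappears after division by p^e. For the upper bound the obstacle is that, for k > 0, the
  leading k-minor of X lies in m and cannot be cancelled modulo m^[q]. The parameter s must
  therefore be an indeterminate outside m, and cancelling it is harmless because m^[q] is a monomial
  ideal not involving s. Both halves produce (m - k)(n - k) by counting the cells (i, j) with i, j
  >= k (indices from 0): as what is left of all diagonals after their first k cells, and as the
  entries of the Schur complement. The number N is t!, which clears all denominators t - k.\<close>

interpretation idl: Modules.module "(*) :: 'b::comm_ring_1 \<Rightarrow> 'b \<Rightarrow> 'b"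
  by unfold_locales (auto simp: algebra_simps)

declare idl.scale_scale [simp del] \<comment> \<open>it loops with \<open>mult.assoc\<close>\<close>

lemma gen_ideal_eq_span: "gen_ideal S = idl.span S"
  unfolding gen_ideal_def idl.span_explicit by auto

section \<open>Elementwise products of generating sets and the ideals they span\<close>

lemma set_times_mono: "A \<subseteq> A' \<Longrightarrow> B \<subseteq> B' \<Longrightarrow> A * B \<subseteq> A' * (B' :: 'b::times set)"
  by (auto simp: set_times_def)

lemma set_power_mono: "A \<subseteq> B \<Longrightarrow> A ^ n \<subseteq> (B :: 'b::comm_monoid_mult set) ^ n"
proof (induction n)
  case (Suc n)
  then show ?case using set_times_mono[of A B "A ^ n" "B ^ n"] by simp
qed simp

lemma power_mem_set_power: "a \<in> A \<Longrightarrow> a ^ n \<in> (A :: 'b::comm_monoid_mult set) ^ n"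
  by (induction n) (auto simp: set_times_def)

lemma prod_mem_set_prod:
  assumes "finite S" "\<And>i. i \<in> S \<Longrightarrow> f i \<in> (A i :: 'b::comm_monoid_mult set)"
  shows "(\<Prod>i\<in>S. f i) \<in> (\<Prod>i\<in>S. A i)"
  using assms by (induction S rule: finite_induct) (auto simp: set_times_def)

lemma prod_list_mem_set_power:
  "set xs \<subseteq> A \<Longrightarrow> prod_list xs \<in> (A :: 'b::comm_monoid_mult set) ^ length xs"
  by (induction xs) (auto simp: set_times_def)

lemma set_power_iff_prod_list:
  "x \<in> (A :: 'b::comm_monoid_mult set) ^ n \<longleftrightarrow> (\<exists>xs. length xs = n \<and> set xs \<subseteq> A \<and> x = prod_list xs)"
proof
  show "x \<in> A ^ n \<Longrightarrow> \<exists>xs. length xs = n \<and> set xs \<subseteq> A \<and> x = prod_list xs"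
  proof (induction n arbitrary: x)
    case (Suc n)
    then obtain a y where a: "a \<in> A" "y \<in> A ^ n" "x = a * y"
      by (auto simp: set_times_def)
    from Suc.IH[OF a(2)] obtain xs where "length xs = n" "set xs \<subseteq> A" "y = prod_list xs"
      by blast
    with a show ?case by (intro exI[of _ "a # xs"]) auto
  qed auto
qed (use prod_list_mem_set_power in auto)

lemma span_mult_left: "x \<in> idl.span S \<Longrightarrow> c * x \<in> idl.span S"
  by (rule idl.span_scale)

lemma span_mult_right: "x \<in> idl.span S \<Longrightarrow> x * c \<in> idl.span (S :: 'b::comm_ring_1 set)"
  by (metis span_mult_left mult.commute)

lemma span_subset_iff: "idl.span A \<subseteq> idl.span B \<longleftrightarrow> A \<subseteq> idl.span B"
  by (meson idl.span_minimal idl.span_superset idl.subspace_span order_trans)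

lemma span_trans: "x \<in> idl.span A \<Longrightarrow> A \<subseteq> idl.span B \<Longrightarrow> x \<in> idl.span B"
  using span_subset_iff by blast

lemma mult_mem_span:
  assumes "a \<in> idl.span A" "b \<in> idl.span B"
  shows "a * b \<in> idl.span (A * B)"
  using assms(1)
proof (induction rule: idl.span_induct_alt)
  case (step c x y)
  have "x * b \<in> idl.span (A * B)"
    using assms(2)
  proof (induction rule: idl.span_induct_alt)
    case (step d u v)
    have "x * u \<in> A * B" using step \<open>x \<in> A\<close> by (auto simp: set_times_def)
    then have "d * (x * u) + x * v \<in> idl.span (A * B)"
      by (rule idl.span_add[OF span_mult_left[OF idl.span_base] step(2)])
    then show ?case by (simp add: algebra_simps)
  qed (simp add: idl.span_zero)
  then have "c * (x * b) + y * b \<in> idl.span (A * B)"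
    by (rule idl.span_add[OF span_mult_left step(2)])
  then show ?case by (simp add: algebra_simps)
qed (simp add: idl.span_zero)

lemma set_times_subset_span:
  "A \<subseteq> idl.span A' \<Longrightarrow> B \<subseteq> idl.span B' \<Longrightarrow> A * B \<subseteq> idl.span (A' * B')"
  unfolding set_times_def[of A B] using mult_mem_span by blast

lemma set_power_subset_span: "A \<subseteq> idl.span B \<Longrightarrow> A ^ n \<subseteq> idl.span (B ^ n)"
proof (induction n)
  case (Suc n)
  then show ?case using set_times_subset_span[of A B "A ^ n" "B ^ n"] by simp
qed (auto intro: idl.span_base)

lemma span_times_subset: "idl.span (A * B) \<subseteq> idl.span B"
  unfolding span_subset_iff set_times_def using span_mult_left idl.span_base by blast

lemma span_one: "idl.span {1 :: 'b::comm_ring_1} = UNIV"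
  using span_mult_left[OF idl.span_base[of 1 "{1}"]] by auto

lemma span_power_antimono: "n \<le> k \<Longrightarrow> idl.span (A ^ k) \<subseteq> idl.span (A ^ n)"
  using span_times_subset[of "A ^ (k - n)" "A ^ n"] by (simp add: power_add[symmetric])

lemma set_power_Un:
  assumes "x \<in> (A \<union> B :: 'b::comm_monoid_mult set) ^ n"
  shows "\<exists>i j. i + j = n \<and> x \<in> A ^ i * B ^ j"
  using assms
proof (induction n arbitrary: x)
  case 0
  then show ?case by (intro exI[of _ 0]) (auto simp: set_times_def)
next
  case (Suc n)
  then obtain a y where a: "a \<in> A \<union> B" "y \<in> (A \<union> B) ^ n" "x = a * y"
    by (auto simp: set_times_def)
  from Suc.IH[OF a(2)] obtain i j where ij: "i + j = n" "y \<in> A ^ i * B ^ j"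
    by blast
  have "x \<in> A * (A ^ i * B ^ j) \<or> x \<in> B * (A ^ i * B ^ j)"
    using a(1,3) ij(2) unfolding set_times_def[of A "A ^ i * B ^ j"] set_times_def[of B "A ^ i * B ^ j"]
    by blast
  then have "x \<in> A ^ Suc i * B ^ j \<or> x \<in> A ^ i * B ^ Suc j"
    by (auto simp: ac_simps)
  then show ?case using ij(1) by (metis add_Suc add_Suc_right)
qed

text \<open>The relation is stated for generating sets: \<open>L ^ n\<close> consists of n-fold
  products, and \<open>idl.span\<close> turns them into an ideal. The loss h must be uniform in l,
  otherwise it would not vanish in the limit.\<close>

definition asymp_in :: "'b::comm_ring_1 set \<Rightarrow> 'b set \<Rightarrow> bool" (infix "\<preceq>\<^sub>a" 50) where
  "L \<preceq>\<^sub>a J \<longleftrightarrow> (\<exists>h. \<forall>l. L ^ (l + h) \<subseteq> idl.span (J ^ l))"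

lemma asymp_in_subset_span: "L \<subseteq> idl.span J \<Longrightarrow> L \<preceq>\<^sub>a J"
  unfolding asymp_in_def by (rule exI[of _ 0]) (simp add: set_power_subset_span)

lemma asymp_in_trans [trans]:
  assumes "L \<preceq>\<^sub>a J" "J \<preceq>\<^sub>a K"
  shows "L \<preceq>\<^sub>a K"
proof -
  from assms obtain h h' where h: "\<And>l. L ^ (l + h) \<subseteq> idl.span (J ^ l)"
    and h': "\<And>l. J ^ (l + h') \<subseteq> idl.span (K ^ l)"
    unfolding asymp_in_def by blast
  have "L ^ (l + (h' + h)) \<subseteq> idl.span (K ^ l)" for l
    using order_trans[OF h[of "l + h'"], of "idl.span (K ^ l)"] h'[of l]
    by (simp add: add.assoc span_subset_iff)
  then show ?thesis unfolding asymp_in_def by blast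
qed

lemma asymp_in_times:
  assumes "L \<preceq>\<^sub>a J" "L' \<preceq>\<^sub>a J'"
  shows "L * L' \<preceq>\<^sub>a J * J'"
proof -
  from assms obtain h h' where h: "\<And>l. L ^ (l + h) \<subseteq> idl.span (J ^ l)"
    and h': "\<And>l. L' ^ (l + h') \<subseteq> idl.span (J' ^ l)"
    unfolding asymp_in_def by blast
  have "(L * L') ^ (l + (h + h')) \<subseteq> idl.span ((J * J') ^ l)" for l
  proof -
    have "L ^ (l + (h + h')) \<subseteq> idl.span (J ^ l)"
      using h[of "l + h'"] span_power_antimono[of l "l + h'" J] by (auto simp: ac_simps)
    moreover have "L' ^ (l + (h + h')) \<subseteq> idl.span (J' ^ l)"
      using h'[of "l + h"] span_power_antimono[of l "l + h" J'] by (auto simp: ac_simps)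
    ultimately show ?thesis
      unfolding power_mult_distrib by (rule set_times_subset_span)
  qed
  then show ?thesis unfolding asymp_in_def by blast
qed

lemma asymp_in_refl: "L \<preceq>\<^sub>a L"
  by (simp add: asymp_in_subset_span idl.span_superset)

lemma asymp_in_Un:
  assumes "L \<preceq>\<^sub>a J" "L' \<preceq>\<^sub>a J"
  shows "L \<union> L' \<preceq>\<^sub>a J"
proof -
  from assms obtain h h' where h: "\<And>l. L ^ (l + h) \<subseteq> idl.span (J ^ l)"
    and h': "\<And>l. L' ^ (l + h') \<subseteq> idl.span (J ^ l)"
    unfolding asymp_in_def by blast
  have "(L \<union> L') ^ (l + (h + h')) \<subseteq> idl.span (J ^ l)" for l
  proof
    fix x assume "x \<in> (L \<union> L') ^ (l + (h + h'))"
    then obtain i j where ij: "i + j = l + (h + h')" "x \<in> L ^ i * L' ^ j"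
      using set_power_Un by blast
    \<comment> \<open>With truncated subtraction the claim also covers i < e: then
      \<open>J ^ 0 = {1}\<close> spans the whole ring.\<close>
    have *: "M ^ i \<subseteq> idl.span (J ^ (i - e))" if "\<And>l. M ^ (l + e) \<subseteq> idl.span (J ^ l)" for M e i
    proof (cases "e \<le> i")
      case True
      then show ?thesis using that[of "i - e"] by simp
    next
      case False
      then show ?thesis by (simp add: span_one)
    qed
    have "x \<in> idl.span (J ^ (i - h) * J ^ (j - h'))"
      by (rule subsetD[OF set_times_subset_span[OF *[OF h] *[OF h']] ij(2)])
    moreover have "l \<le> (i - h) + (j - h')" using ij(1) by simp
    ultimately show "x \<in> idl.span (J ^ l)"
      using span_power_antimono[of l "(i - h) + (j - h')" J] by (auto simp: power_add)
  qed
  then show ?thesis unfolding asymp_in_def by blast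
qed

text \<open>The losses of the single elements add up, so finiteness is essential; it allows
  containments to be checked one product of minors at a time.\<close>

lemma asymp_in_finite:
  assumes "finite L" "\<And>f. f \<in> L \<Longrightarrow> {f} \<preceq>\<^sub>a J"
  shows "L \<preceq>\<^sub>a J"
  using assms
proof (induction L rule: finite_induct)
  case empty
  then show ?case by (simp add: asymp_in_subset_span)
next
  case (insert f L)
  then have "{f} \<union> L \<preceq>\<^sub>a J"
    by (intro asymp_in_Un) blast+
  then show ?case by simp
qed

text \<open>The hypothesis is an integral equation of degree 2 for f over J. Iterating it puts
  \<open>f ^ Suc l\<close> into f J^l + J^(l+1), hence into J^l, so the loss is 1.\<close>

lemma asymp_in_quadratic:
  assumes "f * f \<in> idl.span ({f} * J \<union> J * J)"
  shows "{f} \<preceq>\<^sub>a J"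
proof -
  have mem: "f ^ Suc l \<in> idl.span ({f} * J ^ l \<union> J ^ Suc l)" for l
  proof (induction l)
    case 0
    show ?case by (auto intro: idl.span_base simp: set_times_def)
  next
    case (Suc l)
    let ?S = "{f} * J ^ Suc l \<union> J ^ Suc (Suc l)"
    have mem: "f ^ Suc (Suc l) \<in> idl.span ({f} * ({f} * J ^ l \<union> J ^ Suc l))"
      using mult_mem_span[OF idl.span_base[of f "{f}"] Suc.IH] by simp
    have "{f} * ({f} * J ^ l \<union> J ^ Suc l) \<subseteq> idl.span ?S"
    proof
      fix x assume "x \<in> {f} * ({f} * J ^ l \<union> J ^ Suc l)"
      then consider g where "g \<in> J ^ l" "x = g * (f * f)" | "x \<in> {f} * J ^ Suc l"
        by (auto simp: set_times_def)
      then show "x \<in> idl.span ?S"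
      proof cases
        case 1
        have "x \<in> idl.span (J ^ l * ({f} * J \<union> J * J))"
          using mult_mem_span[OF idl.span_base[OF 1(1)] assms] 1(2) by simp
        moreover have "J ^ l * ({f} * J \<union> J * J) = ?S"
        proof -
          have "A * (B \<union> C) = A * B \<union> A * C" for A B C :: "'a set"
            by (auto simp: set_times_def)
          then show ?thesis by (simp add: ac_simps)
        qed
        ultimately show ?thesis by simp
      qed (auto intro: idl.span_base)
    qed
    with mem show ?case by (rule span_trans)
  qed
  have "{f} ^ (l + 1) \<subseteq> idl.span (J ^ l)" for l
  proof -
    have "{f} * J ^ l \<union> J ^ Suc l \<subseteq> idl.span (J ^ l)"
      using span_times_subset[of "{f}" "J ^ l"] span_times_subset[of J "J ^ l"]
        idl.span_superset[of "{f} * J ^ l"] idl.span_superset[of "J * J ^ l"] by auto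
    moreover have "{f} ^ (l + 1) = {f ^ Suc l}"
      by (induction l) (auto simp: set_times_def)
    ultimately show ?thesis using span_trans[OF mem[of l]] by simp
  qed
  then show ?thesis unfolding asymp_in_def by blast
qed

section \<open>Exchange relations between minors\<close>

text \<open>Rows and columns are selected by arbitrary functions: a single row can be replaced
  without sorting, and a repeated row just gives 0. The matrix is arbitrary too, so that the same
  facts serve \<open>var\<close> and its perturbations.\<close>

definition mnr :: "(nat \<Rightarrow> nat \<Rightarrow> 'b::comm_ring_1) \<Rightarrow> nat \<Rightarrow> (nat \<Rightarrow> nat) \<Rightarrow> (nat \<Rightarrow> nat) \<Rightarrow> 'b" where
  "mnr x n \<alpha> \<gamma> = Determinant.det (Matrix.mat n n (\<lambda>(i, j). x (\<alpha> i) (\<gamma> j)))"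

definition mnrs :: "(nat \<Rightarrow> nat \<Rightarrow> 'b::comm_ring_1) \<Rightarrow> nat \<Rightarrow> nat \<Rightarrow> nat \<Rightarrow> 'b set" where
  "mnrs x m n a = {mnr x a \<alpha> \<gamma> | \<alpha> \<gamma>. \<alpha> \<in> {..<a} \<rightarrow> {..<m} \<and> \<gamma> \<in> {..<a} \<rightarrow> {..<n}}"

lemma mnr_cong:
  "\<lbrakk>\<And>i. i < n \<Longrightarrow> \<alpha> i = \<alpha>' i; \<And>i. i < n \<Longrightarrow> \<gamma> i = \<gamma>' i\<rbrakk> \<Longrightarrow> mnr x n \<alpha> \<gamma> = mnr x n \<alpha>' \<gamma>'"
  unfolding mnr_def by (intro arg_cong[where f = Determinant.det] eq_matI) auto

lemma mnr_eq_sum: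
  "mnr x t \<alpha> \<gamma> = (\<Sum>\<sigma> | \<sigma> permutes {..<t}. of_int (sign \<sigma>) * (\<Prod>i<t. x (\<alpha> i) (\<gamma> (\<sigma> i))))"
proof -
  have *: "{0..<t} = {..<t}" by auto
  show ?thesis
    unfolding mnr_def
    by (subst det_def'[of _ t]) (auto simp: * intro!: sum.cong prod.cong dest: permutes_in_image)
qed

lemma mnr_0 [simp]: "mnr x 0 \<alpha> \<gamma> = 1"
  by (simp add: mnr_def det_def)

lemma mnr_eq_0_rows:
  assumes "i < n" "j < n" "i \<noteq> j" "\<alpha> i = \<alpha> j"
  shows "mnr x n \<alpha> \<gamma> = 0"
  unfolding mnr_def
  by (rule Determinant.det_identical_rows[of _ n i j]) (use assms in auto)

lemma mat_delete_minor:
  "mat_delete (Matrix.mat (Suc n) (Suc n) (\<lambda>(i, j). x (\<alpha> i) (\<gamma> j))) i j =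
     Matrix.mat n n (\<lambda>(i', j'). x ((\<alpha> \<circ> insert_index i) i') ((\<gamma> \<circ> insert_index j) j'))"
  unfolding mat_delete_def insert_index_def by (intro eq_matI) auto

lemma mnr_expand_col:
  assumes "j \<le> n"
  shows "mnr x (Suc n) \<alpha> \<gamma> =
    (\<Sum>i\<le>n. x (\<alpha> i) (\<gamma> j) * ((-1) ^ (i + j) * mnr x n (\<alpha> \<circ> insert_index i) (\<gamma> \<circ> insert_index j)))"
  using assms unfolding mnr_def
  by (subst laplace_expansion_column[of _ "Suc n" j])
     (auto simp: cofactor_def mat_delete_minor lessThan_Suc_atMost intro!: sum.cong)

lemma mnr_expand_row:
  assumes "i \<le> n"
  shows "mnr x (Suc n) \<alpha> \<gamma> =
    (\<Sum>j\<le>n. x (\<alpha> i) (\<gamma> j) * ((-1) ^ (i + j) * mnr x n (\<alpha> \<circ> insert_index i) (\<gamma> \<circ> insert_index j)))"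
  using assms unfolding mnr_def
  by (subst laplace_expansion_row[of _ "Suc n" i])
     (auto simp: cofactor_def mat_delete_minor lessThan_Suc_atMost intro!: sum.cong)

lemma mnr_mem_mnrs:
  "\<alpha> \<in> {..<a} \<rightarrow> {..<m} \<Longrightarrow> \<gamma> \<in> {..<a} \<rightarrow> {..<n} \<Longrightarrow> mnr x a \<alpha> \<gamma> \<in> mnrs x m n a"
  unfolding mnrs_def by blast

lemma insert_index_funcset:
  "\<alpha> \<in> {..<Suc a} \<rightarrow> S \<Longrightarrow> \<alpha> \<circ> insert_index i \<in> {..<a} \<rightarrow> S"
  by (auto simp: insert_index_def)

lemma mnrs_0 [simp]: "mnrs x m n 0 = {1}"
  by (auto simp: mnrs_def)

lemma finite_mnrs: "finite (mnrs x m n a)"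
proof (rule finite_subset)
  show "mnrs x m n a \<subseteq> (\<lambda>(\<alpha>, \<gamma>). mnr x a \<alpha> \<gamma>) `
      (({..<a} \<rightarrow>\<^sub>E {..<m}) \<times> ({..<a} \<rightarrow>\<^sub>E {..<n}))"
  proof
    fix f assume "f \<in> mnrs x m n a"
    then obtain \<alpha> \<gamma> where *: "\<alpha> \<in> {..<a} \<rightarrow> {..<m}" "\<gamma> \<in> {..<a} \<rightarrow> {..<n}" "f = mnr x a \<alpha> \<gamma>"
      by (auto simp: mnrs_def)
    have "f = mnr x a (restrict \<alpha> {..<a}) (restrict \<gamma> {..<a})"
      unfolding * by (rule mnr_cong) auto
    then show "f \<in> (\<lambda>(\<alpha>, \<gamma>). mnr x a \<alpha> \<gamma>) ` (({..<a} \<rightarrow>\<^sub>E {..<m}) \<times> ({..<a} \<rightarrow>\<^sub>E {..<n}))"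
      using * by (intro image_eqI[of _ _ "(restrict \<alpha> {..<a}, restrict \<gamma> {..<a})"]) auto
  qed
qed (auto intro!: finite_PiE)

lemma mnrs_Suc_subset: "mnrs x m n (Suc a) \<subseteq> idl.span (mnrs x m n a)"
proof
  fix f assume "f \<in> mnrs x m n (Suc a)"
  then obtain \<alpha> \<gamma> where *: "\<alpha> \<in> {..<Suc a} \<rightarrow> {..<m}" "\<gamma> \<in> {..<Suc a} \<rightarrow> {..<n}" "f = mnr x (Suc a) \<alpha> \<gamma>"
    by (auto simp: mnrs_def)
  show "f \<in> idl.span (mnrs x m n a)"
    unfolding * mnr_expand_row[OF le0]
    by (intro idl.span_sum span_mult_left idl.span_base mnr_mem_mnrs insert_index_funcset *)
qed

lemma mnrs_antimono: "a \<le> b \<Longrightarrow> mnrs x m n b \<subseteq> idl.span (mnrs x m n a)"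
proof (induction rule: dec_induct)
  case (step k)
  then show ?case using mnrs_Suc_subset[of x m n k] span_subset_iff by blast
qed (rule idl.span_superset)

text \<open>Expand the enlarged first factor along its new column and recombine the second factor
  along its modified row.\<close>

lemma mnr_exchange:
  fixes x :: "nat \<Rightarrow> nat \<Rightarrow> 'b::comm_ring_1"
  assumes "i \<le> b"
  shows "(\<Sum>c\<le>b. (-1) ^ (i + c) * (mnr x (Suc a) (\<alpha>(a := \<beta> i)) (\<gamma>(a := \<epsilon> c)) *
             mnr x b (\<beta> \<circ> insert_index i) (\<epsilon> \<circ> insert_index c))) =
         (\<Sum>s\<le>a. (-1) ^ (s + a) * (mnr x a (\<alpha>(a := \<beta> i) \<circ> insert_index s) \<gamma> *
             mnr x (Suc b) (\<beta>(i := (\<alpha>(a := \<beta> i)) s)) \<epsilon>))"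
proof -
  define \<alpha>' where "\<alpha>' = \<alpha>(a := \<beta> i)"
  define U where "U s = mnr x a (\<alpha>' \<circ> insert_index s) \<gamma>" for s
  define W where "W c = mnr x b (\<beta> \<circ> insert_index i) (\<epsilon> \<circ> insert_index c)" for c
  have 1: "mnr x (Suc a) \<alpha>' (\<gamma>(a := \<epsilon> c)) = (\<Sum>s\<le>a. x (\<alpha>' s) (\<epsilon> c) * ((-1) ^ (s + a) * U s))" for c
  proof -
    have "mnr x a (\<alpha>' \<circ> insert_index s) (\<gamma>(a := \<epsilon> c) \<circ> insert_index a) = U s" for s
      unfolding U_def by (rule mnr_cong) (auto simp: insert_index_def)
    then show ?thesis by (subst mnr_expand_col[of a]) auto
  qed
  have 2: "mnr x (Suc b) (\<beta>(i := \<alpha>' s)) \<epsilon> = (\<Sum>c\<le>b. x (\<alpha>' s) (\<epsilon> c) * ((-1) ^ (i + c) * W c))" for s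
  proof -
    have "mnr x b (\<beta>(i := \<alpha>' s) \<circ> insert_index i) (\<epsilon> \<circ> insert_index c) = W c" for c
      unfolding W_def by (rule mnr_cong) (auto simp: insert_index_def)
    then show ?thesis by (subst mnr_expand_row[OF assms]) auto
  qed
  have "(\<Sum>c\<le>b. (-1) ^ (i + c) * (mnr x (Suc a) \<alpha>' (\<gamma>(a := \<epsilon> c)) * W c)) =
        (\<Sum>c\<le>b. \<Sum>s\<le>a. (-1) ^ (i + c) * (x (\<alpha>' s) (\<epsilon> c) * ((-1) ^ (s + a) * U s) * W c))"
    unfolding 1 by (simp add: sum_distrib_left sum_distrib_right)
  also have "\<dots> = (\<Sum>s\<le>a. \<Sum>c\<le>b. (-1) ^ (s + a) * (U s * (x (\<alpha>' s) (\<epsilon> c) * ((-1) ^ (i + c) * W c))))"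
    by (subst sum.swap) (intro sum.cong refl, simp add: ac_simps)
  also have "\<dots> = (\<Sum>s\<le>a. (-1) ^ (s + a) * (U s * mnr x (Suc b) (\<beta>(i := \<alpha>' s)) \<epsilon>))"
    unfolding 2 by (simp add: sum_distrib_left)
  finally show ?thesis unfolding \<alpha>'_def U_def W_def .
qed

text \<open>In \<open>mnr_exchange\<close> the summand s = a is the original product: deleting the
  appended row \<beta> i restores \<alpha>, and \<beta> is unchanged. The other summands swap
  \<alpha> s with \<beta> i, and the opposite side is visibly a combination of (a+1)-minors times
  b-minors.\<close>

lemma mnr_exchange_mem:
  fixes x :: "nat \<Rightarrow> nat \<Rightarrow> 'b::comm_ring_1"
  assumes "i \<le> b" "\<alpha> \<in> {..<a} \<rightarrow> {..<m}" "\<gamma> \<in> {..<a} \<rightarrow> {..<n}"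
    "\<beta> \<in> {..<Suc b} \<rightarrow> {..<m}" "\<epsilon> \<in> {..<Suc b} \<rightarrow> {..<n}"
  shows "mnr x a \<alpha> \<gamma> * mnr x (Suc b) \<beta> \<epsilon> +
      (\<Sum>s<a. (-1) ^ (s + a) * (mnr x a (\<alpha>(a := \<beta> i) \<circ> insert_index s) \<gamma> *
         mnr x (Suc b) (\<beta>(i := \<alpha> s)) \<epsilon>))
    \<in> idl.span (mnrs x m n (Suc a) * mnrs x m n b)" (is "?l \<in> _")
proof -
  have "mnr x a (\<alpha>(a := \<beta> i) \<circ> insert_index a) \<gamma> = mnr x a \<alpha> \<gamma>"
    by (rule mnr_cong) (auto simp: insert_index_def)
  then have "?l = (\<Sum>s\<le>a. (-1) ^ (s + a) * (mnr x a (\<alpha>(a := \<beta> i) \<circ> insert_index s) \<gamma> *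
             mnr x (Suc b) (\<beta>(i := (\<alpha>(a := \<beta> i)) s)) \<epsilon>))"
    by (subst lessThan_Suc_atMost[symmetric]) (simp add: add.commute)
  also have "\<dots> = (\<Sum>c\<le>b. (-1) ^ (i + c) * (mnr x (Suc a) (\<alpha>(a := \<beta> i)) (\<gamma>(a := \<epsilon> c)) *
             mnr x b (\<beta> \<circ> insert_index i) (\<epsilon> \<circ> insert_index c)))"
    by (rule mnr_exchange[symmetric, OF assms(1)])
  also have "\<dots> \<in> idl.span (mnrs x m n (Suc a) * mnrs x m n b)"
  proof (rule idl.span_sum, rule span_mult_left, rule mult_mem_span)
    fix c assume "c \<in> {..b}"
    then have "\<beta> i < m" "\<epsilon> c < n"
      using assms(1,4,5) by (auto simp: Pi_iff less_Suc_eq_le)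
    then have "\<alpha>(a := \<beta> i) \<in> {..<Suc a} \<rightarrow> {..<m}" "\<gamma>(a := \<epsilon> c) \<in> {..<Suc a} \<rightarrow> {..<n}"
      using assms(2,3) by (auto simp: less_Suc_eq Pi_iff)
    then show "mnr x (Suc a) (\<alpha>(a := \<beta> i)) (\<gamma>(a := \<epsilon> c)) \<in> idl.span (mnrs x m n (Suc a))"
      by (intro idl.span_base mnr_mem_mnrs)
    show "mnr x b (\<beta> \<circ> insert_index i) (\<epsilon> \<circ> insert_index c) \<in> idl.span (mnrs x m n b)"
      by (intro idl.span_base mnr_mem_mnrs insert_index_funcset assms)
  qed
  finally show ?thesis .
qed

text \<open>The parameter d bounds how far the row sets are from nested: d = 0 means that the rows
  of the smaller minor occur in the larger one, d = a is no restriction. The target products are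
  included, so that lowering d step by step leads to them.\<close>

definition exch_set :: "(nat \<Rightarrow> nat \<Rightarrow> 'b::comm_ring_1) \<Rightarrow> nat \<Rightarrow> nat \<Rightarrow> nat \<Rightarrow> nat \<Rightarrow> nat \<Rightarrow> 'b set" where
  "exch_set x m n a b d = mnrs x m n (Suc a) * mnrs x m n b \<union>
     {mnr x a \<alpha> \<gamma> * mnr x (Suc b) \<beta> \<epsilon> | \<alpha> \<gamma> \<beta> \<epsilon>.
        \<alpha> \<in> {..<a} \<rightarrow> {..<m} \<and> \<gamma> \<in> {..<a} \<rightarrow> {..<n} \<and>
        \<beta> \<in> {..<Suc b} \<rightarrow> {..<m} \<and> \<epsilon> \<in> {..<Suc b} \<rightarrow> {..<n} \<and>
        card (\<alpha> ` {..<a} - \<beta> ` {..<Suc b}) \<le> d}"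

text \<open>Since a < b + 1 and the rows are distinct, \<beta> has a row \<beta> i outside \<alpha>.
  A swap with \<alpha> s already among the rows of \<beta> repeats a row in the larger minor, so
  only rows violating nestedness survive in the sum.\<close>

lemma mnr_exchange_reduced:
  fixes x :: "nat \<Rightarrow> nat \<Rightarrow> 'b::comm_ring_1"
  assumes "a \<le> b" and \<alpha>: "\<alpha> \<in> {..<a} \<rightarrow> {..<m}" and \<gamma>: "\<gamma> \<in> {..<a} \<rightarrow> {..<n}"
    and \<beta>: "\<beta> \<in> {..<Suc b} \<rightarrow> {..<m}" and \<epsilon>: "\<epsilon> \<in> {..<Suc b} \<rightarrow> {..<n}"
    and inj: "inj_on \<alpha> {..<a}" "inj_on \<beta> {..<Suc b}"
  obtains i where "i \<le> b" "\<beta> i \<notin> \<alpha> ` {..<a}"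
    "mnr x a \<alpha> \<gamma> * mnr x (Suc b) \<beta> \<epsilon> +
      (\<Sum>s | s < a \<and> \<alpha> s \<notin> \<beta> ` {..<Suc b}. (-1) ^ (s + a) * (mnr x a (\<alpha>(a := \<beta> i) \<circ> insert_index s) \<gamma> *
         mnr x (Suc b) (\<beta>(i := \<alpha> s)) \<epsilon>))
    \<in> idl.span (mnrs x m n (Suc a) * mnrs x m n b)"
proof -
  have "card (\<alpha> ` {..<a}) < card (\<beta> ` {..<Suc b})"
    using assms(1) inj by (simp add: card_image)
  then have "\<not> \<beta> ` {..<Suc b} \<subseteq> \<alpha> ` {..<a}"
    using card_mono[of "\<alpha> ` {..<a}" "\<beta> ` {..<Suc b}"] by auto
  then obtain i where i: "i \<le> b" "\<beta> i \<notin> \<alpha> ` {..<a}" by (metis image_subsetI lessThan_iff less_Suc_eq_le)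
  have "mnr x (Suc b) (\<beta>(i := \<alpha> s)) \<epsilon> = 0" if "s < a" "\<alpha> s \<in> \<beta> ` {..<Suc b}" for s
  proof -
    from that obtain j where j: "j < Suc b" "\<alpha> s = \<beta> j" by auto
    with i(2) that have "j \<noteq> i" by (metis imageI lessThan_iff)
    then show ?thesis using i(1) j by (intro mnr_eq_0_rows[of i _ j]) auto
  qed
  then have "(\<Sum>s<a. (-1) ^ (s + a) * (mnr x a (\<alpha>(a := \<beta> i) \<circ> insert_index s) \<gamma> *
         mnr x (Suc b) (\<beta>(i := \<alpha> s)) \<epsilon>)) =
     (\<Sum>s | s < a \<and> \<alpha> s \<notin> \<beta> ` {..<Suc b}. (-1) ^ (s + a) * (mnr x a (\<alpha>(a := \<beta> i) \<circ> insert_index s) \<gamma> *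
         mnr x (Suc b) (\<beta>(i := \<alpha> s)) \<epsilon>))"
    by (intro sum.mono_neutral_right) auto
  with mnr_exchange_mem[OF i(1) \<alpha> \<gamma> \<beta> \<epsilon>, of x] that[OF i] show ?thesis by simp
qed

lemma mnr_eq_0_if_not_inj: "\<not> inj_on \<alpha> {..<a} \<Longrightarrow> mnr x a \<alpha> \<gamma> = 0"
  unfolding inj_on_def using mnr_eq_0_rows by auto

text \<open>For nested row sets no swap survives in the exchange relation, which leaves the product
  itself in the target ideal.\<close>

lemma exch_set_0_subset:
  assumes "a \<le> b"
  shows "exch_set x m n a b 0 \<subseteq> idl.span (mnrs x m n (Suc a) * mnrs x m n b)"
proof
  fix f assume "f \<in> exch_set x m n a b 0"
  then consider "f \<in> mnrs x m n (Suc a) * mnrs x m n b"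
    | \<alpha> \<gamma> \<beta> \<epsilon> where "\<alpha> \<in> {..<a} \<rightarrow> {..<m}" "\<gamma> \<in> {..<a} \<rightarrow> {..<n}"
        "\<beta> \<in> {..<Suc b} \<rightarrow> {..<m}" "\<epsilon> \<in> {..<Suc b} \<rightarrow> {..<n}"
        "\<alpha> ` {..<a} \<subseteq> \<beta> ` {..<Suc b}" "f = mnr x a \<alpha> \<gamma> * mnr x (Suc b) \<beta> \<epsilon>"
    unfolding exch_set_def by auto
  then show "f \<in> idl.span (mnrs x m n (Suc a) * mnrs x m n b)"
  proof cases
    case 2
    show ?thesis
    proof (cases "inj_on \<alpha> {..<a} \<and> inj_on \<beta> {..<Suc b}")
      case False
      then show ?thesis using 2(6) by (auto simp: idl.span_zero mnr_eq_0_if_not_inj)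
    next
      case True
      have *: "{s. s < a \<and> \<alpha> s \<notin> \<beta> ` {..<Suc b}} = {}" using 2(5) by auto
      show ?thesis
        using mnr_exchange_reduced[OF assms 2(1-4), of x ?thesis] True unfolding * 2(6) by simp
    qed
  qed (rule idl.span_base)
qed

text \<open>Writing f as a combination of exchanged products f(s) modulo the target ideal, the two
  row sets can be swapped back in f * f(s), which makes both new factors closer to being nested.\<close>

lemma exch_set_Suc:
  fixes x :: "nat \<Rightarrow> nat \<Rightarrow> 'b::comm_ring_1"
  assumes "a \<le> b"
  shows "exch_set x m n a b (Suc d) \<preceq>\<^sub>a exch_set x m n a b d"
proof (rule asymp_in_finite)
  have "exch_set x m n a b (Suc d) \<subseteq>
      (\<lambda>(f, g). f * g) ` ((mnrs x m n (Suc a) \<times> mnrs x m n b) \<union> (mnrs x m n a \<times> mnrs x m n (Suc b)))"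
    unfolding exch_set_def set_times_def mnrs_def by auto blast+
  then show "finite (exch_set x m n a b (Suc d))"
    by (rule finite_subset) (auto intro!: finite_mnrs)
  let ?J = "mnrs x m n (Suc a) * mnrs x m n b" and ?G = "exch_set x m n a b d"
  fix f assume "f \<in> exch_set x m n a b (Suc d)"
  then consider "f \<in> ?J"
    | \<alpha> \<gamma> \<beta> \<epsilon> where "\<alpha> \<in> {..<a} \<rightarrow> {..<m}" "\<gamma> \<in> {..<a} \<rightarrow> {..<n}"
        "\<beta> \<in> {..<Suc b} \<rightarrow> {..<m}" "\<epsilon> \<in> {..<Suc b} \<rightarrow> {..<n}"
        "card (\<alpha> ` {..<a} - \<beta> ` {..<Suc b}) \<le> Suc d" "f = mnr x a \<alpha> \<gamma> * mnr x (Suc b) \<beta> \<epsilon>"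
    unfolding exch_set_def by auto
  then show "{f} \<preceq>\<^sub>a ?G"
  proof cases
    case 1
    then show ?thesis by (intro asymp_in_subset_span) (auto simp: exch_set_def intro: idl.span_base)
  next
    case 2
    show ?thesis
    proof (cases "inj_on \<alpha> {..<a} \<and> inj_on \<beta> {..<Suc b}")
      case False
      then show ?thesis using 2(6)
        by (intro asymp_in_subset_span) (auto simp: idl.span_zero mnr_eq_0_if_not_inj)
    next
      case True
      then have inj: "inj_on \<alpha> {..<a}" "inj_on \<beta> {..<Suc b}" by auto
      obtain i where i: "i \<le> b" "\<beta> i \<notin> \<alpha> ` {..<a}" and mem:
        "mnr x a \<alpha> \<gamma> * mnr x (Suc b) \<beta> \<epsilon> +
          (\<Sum>s | s < a \<and> \<alpha> s \<notin> \<beta> ` {..<Suc b}. (-1) ^ (s + a) *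
             (mnr x a (\<alpha>(a := \<beta> i) \<circ> insert_index s) \<gamma> * mnr x (Suc b) (\<beta>(i := \<alpha> s)) \<epsilon>))
         \<in> idl.span ?J"
        by (rule mnr_exchange_reduced[OF assms 2(1-4) inj])
      define S where "S = {s. s < a \<and> \<alpha> s \<notin> \<beta> ` {..<Suc b}}"
      define g where "g s = mnr x a (\<alpha>(a := \<beta> i) \<circ> insert_index s) \<gamma> * mnr x (Suc b) (\<beta>(i := \<alpha> s)) \<epsilon>" for s
      define j where "j = f + (\<Sum>s\<in>S. (-1) ^ (s + a) * g s)"
      have j: "j \<in> idl.span ?J" using mem unfolding j_def g_def S_def 2(6) .
      have "?J \<subseteq> ?G" by (auto simp: exch_set_def)
      then have fj: "f * j \<in> idl.span ({f} * ?G)"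
        using subsetD[OF idl.span_mono[of ?J ?G] j] by (simp add: idl.span_base mult_mem_span)
      have \<beta>m: "\<beta> i < m" using 2(3) i(1) by (auto simp: Pi_iff less_Suc_eq_le)
      have diff1: "\<And>I r A' A B e. \<lbrakk>I \<subseteq> insert r A'; e \<notin> A'; r \<in> B; A' \<subseteq> A\<rbrakk> \<Longrightarrow> I - B \<subseteq> A - B - {e :: nat}"
        by blast
      have diff2: "\<And>B B' r A e. \<lbrakk>B - {r} \<subseteq> B'; e \<in> B'; r \<notin> A\<rbrakk> \<Longrightarrow> A - B' \<subseteq> A - B - {e :: nat}"
        by blast
      have fg: "f * g s \<in> ?G * ?G" if "s \<in> S" for s
      proof -
        have s: "s < a" "\<alpha> s \<notin> \<beta> ` {..<Suc b}" using that by (auto simp: S_def)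
        \<comment> \<open>The four minors in \<open>f * g s\<close> are regrouped. Row \<alpha> s
          stops violating nestedness in both groups: in \<open>?u\<close> it has been replaced by
          \<beta> i, a row of \<beta>; in \<open>?w\<close> it has joined the larger minor, while
          the \<beta> i lost there was not a row of \<alpha>.\<close>
        let ?u = "mnr x a (\<alpha>(a := \<beta> i) \<circ> insert_index s) \<gamma> * mnr x (Suc b) \<beta> \<epsilon>"
        let ?w = "mnr x a \<alpha> \<gamma> * mnr x (Suc b) (\<beta>(i := \<alpha> s)) \<epsilon>"
        have im: "(\<alpha>(a := \<beta> i) \<circ> insert_index s) ` {..<a} \<subseteq> insert (\<beta> i) (\<alpha> ` ({..<a} - {s}))"
        proof (rule image_subsetI)
          fix l assume "l \<in> {..<a}"
          then have "insert_index s l = a \<or> insert_index s l \<in> {..<a} - {s}"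
            by (auto simp: insert_index_def)
          then show "(\<alpha>(a := \<beta> i) \<circ> insert_index s) l \<in> insert (\<beta> i) (\<alpha> ` ({..<a} - {s}))"
            by (cases "insert_index s l = a") simp_all
        qed
        have bi: "\<beta> i \<in> \<beta> ` {..<Suc b}" using i(1) by simp
        have im2: "\<alpha> s \<notin> \<alpha> ` ({..<a} - {s})"
          using inj_on_image_mem_iff[OF inj(1), of s "{..<a} - {s}"] s(1) by simp
        have less: "card T \<le> d" if "T \<subseteq> \<alpha> ` {..<a} - \<beta> ` {..<Suc b} - {\<alpha> s}" for T
        proof -
          have "card T \<le> card (\<alpha> ` {..<a} - \<beta> ` {..<Suc b} - {\<alpha> s})"
            by (rule card_mono[OF _ that]) simp
          also have "\<dots> < card (\<alpha> ` {..<a} - \<beta> ` {..<Suc b})"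
            by (rule card_Diff1_less) (use s in simp_all)
          finally show ?thesis using 2(5) by simp
        qed
        have "?u \<in> ?G"
        proof -
          have "(\<alpha>(a := \<beta> i) \<circ> insert_index s) ` {..<a} - \<beta> ` {..<Suc b} \<subseteq>
              \<alpha> ` {..<a} - \<beta> ` {..<Suc b} - {\<alpha> s}"
            by (rule diff1[OF im im2 bi image_mono]) simp
          then have "card ((\<alpha>(a := \<beta> i) \<circ> insert_index s) ` {..<a} - \<beta> ` {..<Suc b}) \<le> d"
            by (rule less)
          moreover have "\<alpha>(a := \<beta> i) \<circ> insert_index s \<in> {..<a} \<rightarrow> {..<m}"
            using 2(1) \<beta>m by (intro insert_index_funcset) (auto simp: less_Suc_eq Pi_iff)
          ultimately show ?thesis using 2(2,3,4) unfolding exch_set_def by blast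
        qed
        moreover have "?w \<in> ?G"
        proof -
          have "\<beta> ` {..<Suc b} - {\<beta> i} \<subseteq> (\<beta>(i := \<alpha> s)) ` {..<Suc b}"
            by (auto simp: image_iff)
          moreover have "\<alpha> s \<in> (\<beta>(i := \<alpha> s)) ` {..<Suc b}"
            using i(1) by (auto simp: image_iff intro!: bexI[of _ i])
          ultimately have "\<alpha> ` {..<a} - (\<beta>(i := \<alpha> s)) ` {..<Suc b} \<subseteq>
              \<alpha> ` {..<a} - \<beta> ` {..<Suc b} - {\<alpha> s}"
            by (rule diff2[OF _ _ i(2)])
          then have "card (\<alpha> ` {..<a} - (\<beta>(i := \<alpha> s)) ` {..<Suc b}) \<le> d"
            by (rule less)
          moreover have "\<beta>(i := \<alpha> s) \<in> {..<Suc b} \<rightarrow> {..<m}"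
            using 2(1,3) s by (auto simp: Pi_iff)
          ultimately show ?thesis using 2(1,2,4) unfolding exch_set_def by blast
        qed
        moreover have "f * g s = ?u * ?w" unfolding 2(6) g_def by (simp add: ac_simps)
        ultimately show ?thesis by (auto simp: set_times_def)
      qed
      have "f * f = f * j - (\<Sum>s\<in>S. (-1) ^ (s + a) * (f * g s))"
        unfolding j_def by (simp add: algebra_simps sum_distrib_left)
      also have "\<dots> \<in> idl.span ({f} * ?G \<union> ?G * ?G)"
      proof (rule idl.span_diff)
        show "f * j \<in> idl.span ({f} * ?G \<union> ?G * ?G)"
          using fj idl.span_mono[of "{f} * ?G" "{f} * ?G \<union> ?G * ?G"] by auto
        show "(\<Sum>s\<in>S. (-1) ^ (s + a) * (f * g s)) \<in> idl.span ({f} * ?G \<union> ?G * ?G)"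
          by (rule idl.span_sum, rule span_mult_left, rule idl.span_base) (use fg in blast)
      qed
      finally show ?thesis by (rule asymp_in_quadratic)
    qed
  qed
qed

text \<open>Start at d = a, where the condition on the row sets is void, and descend to the nested
  case d = 0.\<close>

lemma mnrs_exchange:
  fixes x :: "nat \<Rightarrow> nat \<Rightarrow> 'b::comm_ring_1"
  assumes "a \<le> b"
  shows "mnrs x m n a * mnrs x m n (Suc b) \<preceq>\<^sub>a mnrs x m n (Suc a) * mnrs x m n b"
proof -
  have *: "exch_set x m n a b d \<preceq>\<^sub>a mnrs x m n (Suc a) * mnrs x m n b" for d
  proof (induction d)
    case 0
    show ?case by (intro asymp_in_subset_span exch_set_0_subset assms)
  next
    case (Suc d)
    show ?case by (rule asymp_in_trans[OF exch_set_Suc[OF assms] Suc])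
  qed
  have "card (\<alpha> ` {..<a} - \<beta> ` {..<Suc b}) \<le> a" for \<alpha> \<beta> :: "nat \<Rightarrow> nat"
    using card_image_le[of "{..<a}" \<alpha>] card_mono[of "\<alpha> ` {..<a}" "\<alpha> ` {..<a} - \<beta> ` {..<Suc b}"]
    by fastforce
  then have "mnrs x m n a * mnrs x m n (Suc b) \<subseteq> exch_set x m n a b a"
    unfolding exch_set_def mnrs_def by (auto simp: set_times_def)
  then have "mnrs x m n a * mnrs x m n (Suc b) \<preceq>\<^sub>a exch_set x m n a b a"
    using idl.span_superset by (intro asymp_in_subset_span) blast
  from asymp_in_trans[OF this *] show ?thesis .
qed

section \<open>Balancing products of minors\<close>

lemma one_times_set: "{1} * A = (A :: 'b::monoid_mult set)"
  by (auto simp: set_times_def)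

text \<open>Each factor of size at least t lies in I_t by Laplace expansion; the smaller factors are
  absorbed as coefficients.\<close>

lemma prod_mnrs_subset:
  "(\<Prod>b\<in>#S. mnrs x m n b) \<subseteq> idl.span (mnrs x m n t ^ size {#b \<in># S. t \<le> b#})"
proof (induction S)
  case empty
  then show ?case by (simp add: span_one)
next
  case (add b S)
  show ?case
  proof (cases "t \<le> b")
    case True
    then show ?thesis using set_times_subset_span[OF mnrs_antimono[OF True] add] by simp
  next
    case False
    then show ?thesis
      using order_trans[OF set_times_subset_span[OF idl.span_superset add] span_times_subset] by simp
  qed
qed

text \<open>If no size lies strictly between k and t, then sizes below t contribute 0 to both
  truncated sums, and each size from t on contributes t - k more to the first. On such a range of k
  the sum is affine in k.\<close>

lemma sum_mset_diff_eq:
  assumes "k \<le> t" "\<And>x. x \<in># S \<Longrightarrow> x < t \<Longrightarrow> x \<le> k"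
  shows "(\<Sum>x\<in>#S. x - k) = (\<Sum>x\<in>#S. x - t) + size {#x \<in># S. t \<le> x#} * (t - k)"
  using assms(2)
proof (induction S)
  case (add x S)
  have IH: "(\<Sum>x\<in>#S. x - k) = (\<Sum>x\<in>#S. x - t) + size {#x \<in># S. t \<le> x#} * (t - k)"
    using add.prems by (intro add.IH) auto
  have "x < t \<Longrightarrow> x \<le> k" using add.prems by auto
  then show ?case using IH assms(1) by (cases "t \<le> x") auto
qed simp

text \<open>Greedy balancing: while fewer than s sizes reach t, replace the largest size a < t and
  some size b > t by a + 1 and b - 1, which the exchange containment permits. The excess over t
  drops, and the hypothesis must be seen to persist for every k < t.\<close>

lemma prod_mnrs_asymp_in:
  fixes x :: "nat \<Rightarrow> nat \<Rightarrow> 'b::comm_ring_1"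
  assumes "t > 0" "\<And>k. k < t \<Longrightarrow> s * (t - k) \<le> (\<Sum>b\<in>#S. b - k)"
  shows "(\<Prod>b\<in>#S. mnrs x m n b) \<preceq>\<^sub>a mnrs x m n t ^ s"
  using assms(2)
proof (induction "\<Sum>b\<in>#S. b - t" arbitrary: S rule: less_induct)
  case less
  define c where "c = size {#b \<in># S. t \<le> b#}"
  show ?case
  proof (cases "s \<le> c")
    case True
    have "(\<Prod>b\<in>#S. mnrs x m n b) \<subseteq> idl.span (mnrs x m n t ^ s)"
      using order_trans[OF prod_mnrs_subset span_power_antimono[OF True[unfolded c_def]]] .
    then show ?thesis by (rule asymp_in_subset_span)
  next
    case False
    \<comment> \<open>Otherwise the sum at k = t - 1 would be exactly c, since only sizes equal to t
      contribute, and the hypothesis would give s <= c.\<close>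
    have "\<exists>b\<in>#S. t < b"
    proof (rule ccontr)
      assume *: "\<not> (\<exists>b\<in>#S. t < b)"
      have "(\<Sum>b\<in>#S. b - (t - 1)) = (\<Sum>b\<in>#S. b - t) + c * (t - (t - 1))"
        unfolding c_def by (rule sum_mset_diff_eq) auto
      also have "(\<Sum>b\<in>#S. b - t) = 0" using * by (auto simp: not_less)
      finally show False using less.prems[of "t - 1"] False assms(1) by simp
    qed
    then obtain b where b: "b \<in># S" "t < b" by blast
    define A where "A = {x \<in> set_mset S. x < t}"
    \<comment> \<open>If no size is below t, a factor of size 0 is inserted: \<open>mnrs\<close> is
      then {1}, and the sums are unaffected. This is why \<open>S2\<close> completes a multiset
      equivalent to S rather than S itself.\<close>
    define a where "a = (if A = {} then 0 else Max A)"
    have A: "finite A" by (simp add: A_def)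
    have a_max: "x \<le> a" if "x \<in># S" "x < t" for x
      using that A by (auto simp: a_def A_def)
    have "a \<in> A" if "A \<noteq> {}" using that A by (simp add: a_def)
    then have at: "a < t" using assms(1) by (cases "A = {}") (auto simp: a_def A_def)
    obtain S2 where S2: "(\<Prod>b\<in>#S. mnrs x m n b) = (\<Prod>b\<in>#add_mset a (add_mset b S2). mnrs x m n b)"
      "\<And>k. (\<Sum>b\<in>#S. b - k) = (\<Sum>b\<in>#add_mset a (add_mset b S2). b - k)"
      "size {#b \<in># add_mset a (add_mset b S2). t \<le> b#} = c"
      "\<And>x. x \<in># add_mset a (add_mset b S2) \<Longrightarrow> x < t \<Longrightarrow> x \<le> a"
    proof (cases "A = {}")
      case True
      have "S = add_mset b (S - {#b#})" using b by simp
      with True at a_max show ?thesis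
        by (intro that[of "S - {#b#}"]) (simp_all add: a_def c_def one_times_set, blast)
    next
      case False
      with \<open>A \<noteq> {} \<Longrightarrow> a \<in> A\<close> have "a \<in># S" by (auto simp: A_def)
      moreover from this have "b \<in># S - {#a#}" using b at by (simp add: in_diff_count)
      ultimately obtain R where R: "S = add_mset a (add_mset b R)"
        by (metis insert_DiffM)
      show ?thesis
      proof (rule that[of R])
        show "x \<le> a" if "x \<in># add_mset a (add_mset b R)" "x < t" for x
          using a_max[of x] that unfolding R by blast
      qed (simp_all add: R c_def)
    qed
    define S' where "S' = add_mset (Suc a) (add_mset (b - 1) S2)"
    have "(\<Prod>b\<in>#S'. mnrs x m n b) \<preceq>\<^sub>a mnrs x m n t ^ s"
    proof (rule less.hyps)
      show "(\<Sum>b\<in>#S'. b - t) < (\<Sum>b\<in>#S. b - t)"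
        using at b(2) by (simp add: S2(2) S'_def)
    next
      fix k assume k: "k < t"
      show "s * (t - k) \<le> (\<Sum>b\<in>#S'. b - k)"
      proof (cases "k \<le> a")
        case True
        then show ?thesis using less.prems[OF k] at b(2) by (simp add: S2(2) S'_def)
      next
        case False
        define T where "T = (\<Sum>b\<in>#S. b - t)"
        have sum_eq: "(\<Sum>b\<in>#S. b - k) = T + c * (t - k)" if "a \<le> k" "k \<le> t" for k
          unfolding T_def S2(2) S2(3)[symmetric]
          using that S2(4) by (intro sum_mset_diff_eq) fastforce+
        \<comment> \<open>For a < k < t the move costs 1 in the sum. The slack comes from the
          hypothesis at a: the sum is affine on [a, t], and s > c turns the inequality at a into a
          strict one at k.\<close>
        have "s * (t - a) \<le> T + c * (t - a)"
          using less.prems[OF at] sum_eq[of a] at by simp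
        then have "(s - c) * (t - a) \<le> T" by (simp add: diff_mult_distrib)
        moreover have "(s - c) * (t - k + 1) \<le> (s - c) * (t - a)"
          using False k by (intro mult_le_mono2) auto
        moreover have "(s - c) * (t - k) + 1 \<le> (s - c) * (t - k + 1)"
          using \<open>\<not> s \<le> c\<close> by simp
        ultimately have "(s - c) * (t - k) + 1 \<le> T" by linarith
        then have "s * (t - k) + 1 \<le> T + c * (t - k)"
          using \<open>\<not> s \<le> c\<close> by (simp add: diff_mult_distrib)
        also have "\<dots> = (\<Sum>b\<in>#S. b - k)" using sum_eq[of k] False k by simp
        also have "\<dots> = (\<Sum>b\<in>#S'. b - k) + 1"
          using False k b(2) by (simp add: S2(2) S'_def)
        finally show ?thesis by simp
      qed
    qed
    moreover have "(\<Prod>b\<in>#S. mnrs x m n b) \<preceq>\<^sub>a (\<Prod>b\<in>#S'. mnrs x m n b)"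
    proof -
      have "mnrs x m n a * mnrs x m n (Suc (b - 1)) \<preceq>\<^sub>a mnrs x m n (Suc a) * mnrs x m n (b - 1)"
        using at b(2) by (intro mnrs_exchange) auto
      from asymp_in_times[OF this asymp_in_refl[of "\<Prod>b\<in>#S2. mnrs x m n b"]]
      show ?thesis using b(2) by (simp add: S2(1) S'_def mult.assoc)
    qed
    ultimately show ?thesis by (blast intro: asymp_in_trans)
  qed
qed

section \<open>The leading monomial of the product of diagonal minors\<close>

lemma minor_eq_mnr: "minor t rs cs = mnr var t rs cs"
  unfolding minor_def mnr_eq_sum ..

section \<open>Weights and leading monomials\<close>

lemma keys_sum_subset: "Poly_Mapping.keys (\<Sum>i\<in>A. f i) \<subseteq> (\<Union>i\<in>A. Poly_Mapping.keys (f i))"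
proof (induction A rule: infinite_finite_induct)
  case (insert x A)
  then show ?case using Poly_Mapping.keys_add[of "f x" "sum f A"] by auto
qed auto

text \<open>The indeterminate x(i,j) gets weight i * j, for which the main diagonal is the strictly
  heaviest term of a minor on consecutive rows and columns. An additive weight suffices here in
  place of a monomial order.\<close>

definition wt :: "(nat \<times> nat \<Rightarrow>\<^sub>0 nat) \<Rightarrow> nat" where
  "wt \<mu> = (\<Sum>p\<in>Poly_Mapping.keys \<mu>. Poly_Mapping.lookup \<mu> p * (fst p * snd p))"

lemma wt_add: "wt (\<mu> + \<nu>) = wt \<mu> + wt \<nu>"
  unfolding wt_def by (rule setsum_keys_plus_distrib) (auto simp: algebra_simps)

lemma wt_zero [simp]: "wt 0 = 0"
  by (simp add: wt_def)

lemma wt_single [simp]: "wt (Poly_Mapping.single p k) = k * (fst p * snd p)"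
  by (simp add: wt_def)

lemma wt_sum: "wt (\<Sum>i\<in>A. f i) = (\<Sum>i\<in>A. wt (f i))"
  by (induction A rule: infinite_finite_induct) (auto simp: wt_add)

text \<open>The leading coefficient is required to be 1 and the gap to be strict, so that leading
  terms multiply over any commutative ring.\<close>

definition has_lead :: "'a::comm_ring_1 mpoly \<Rightarrow> (nat \<times> nat \<Rightarrow>\<^sub>0 nat) \<Rightarrow> bool" where
  "has_lead f M \<longleftrightarrow> (\<exists>g. f = Poly_Mapping.single M 1 + g \<and> (\<forall>\<mu>\<in>Poly_Mapping.keys g. wt \<mu> < wt M))"

lemma has_lead_one: "has_lead 1 0"
  unfolding has_lead_def by (intro exI[of _ 0]) simp

lemma has_lead_mult:
  assumes "has_lead f M" "has_lead f' M'"
  shows "has_lead (f * f') (M + M')"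
proof -
  from assms obtain g g' where g: "f = Poly_Mapping.single M 1 + g" "\<And>\<mu>. \<mu> \<in> Poly_Mapping.keys g \<Longrightarrow> wt \<mu> < wt M"
    and g': "f' = Poly_Mapping.single M' 1 + g'" "\<And>\<mu>. \<mu> \<in> Poly_Mapping.keys g' \<Longrightarrow> wt \<mu> < wt M'"
    unfolding has_lead_def by blast
  define h where "h = Poly_Mapping.single M 1 * g' + g * f'"
  have "f * f' = Poly_Mapping.single (M + M') 1 + h"
    unfolding h_def g(1) by (simp add: g'(1) algebra_simps mult_single)
  moreover have "wt \<mu> < wt (M + M')" if "\<mu> \<in> Poly_Mapping.keys h" for \<mu>
  proof -
    have le: "wt \<nu> \<le> wt M'" if "\<nu> \<in> Poly_Mapping.keys f'" for \<nu>
    proof -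
      have "\<nu> \<in> Poly_Mapping.keys (Poly_Mapping.single M' (1::'a)) \<union> Poly_Mapping.keys g'"
        using that Poly_Mapping.keys_add[of "Poly_Mapping.single M' 1" g'] g'(1) by auto
      then have "\<nu> = M' \<or> \<nu> \<in> Poly_Mapping.keys g'" by (auto split: if_splits)
      then show ?thesis using g'(2)[of \<nu>] by auto
    qed
    from that consider "\<mu> \<in> Poly_Mapping.keys (Poly_Mapping.single M 1 * g')" | "\<mu> \<in> Poly_Mapping.keys (g * f')"
      unfolding h_def using Poly_Mapping.keys_add[of "Poly_Mapping.single M 1 * g'" "g * f'"] by blast
    then show ?thesis
    proof cases
      case 1
      then obtain a \<nu> where *: "a \<in> Poly_Mapping.keys (Poly_Mapping.single M (1::'a))" "\<nu> \<in> Poly_Mapping.keys g'" "\<mu> = a + \<nu>"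
        using keys_mult[of "Poly_Mapping.single M 1" g'] by blast
      from *(1) have "a = M" by (auto split: if_splits)
      then show ?thesis using g'(2)[OF *(2)] *(3) by (simp add: wt_add)
    next
      case 2
      then obtain a \<nu> where *: "a \<in> Poly_Mapping.keys g" "\<nu> \<in> Poly_Mapping.keys f'" "\<mu> = a + \<nu>"
        using keys_mult[of g f'] by blast
      show ?thesis using g(2)[OF *(1)] le[OF *(2)] *(3) by (simp add: wt_add)
    qed
  qed
  ultimately show ?thesis unfolding has_lead_def by blast
qed

lemma has_lead_prod:
  "(\<And>i. i \<in> A \<Longrightarrow> has_lead (f i) (M i)) \<Longrightarrow> has_lead (\<Prod>i\<in>A. f i) (\<Sum>i\<in>A. M i)"
  by (induction A rule: infinite_finite_induct) (auto intro: has_lead_one has_lead_mult)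

lemma has_lead_lookup: "has_lead f M \<Longrightarrow> Poly_Mapping.lookup f M = 1"
  unfolding has_lead_def by (auto simp: lookup_add in_keys_iff)

lemma prod_var:
  "(\<Prod>i\<in>A. var (r i) (c i)) = Poly_Mapping.single (\<Sum>i\<in>A. Poly_Mapping.single (r i, c i) 1) (1 :: 'a::comm_ring_1)"
  by (induction A rule: infinite_finite_induct) (auto simp: var_def mult_single)

text \<open>Rearrangement inequality: the sum of (\<sigma> i - i)^2 is positive, and expanding it
  bounds the sum of i * \<sigma> i. The offsets r and c only add terms that are invariant under
  \<sigma>.\<close>

lemma sum_mult_permutes_less:
  fixes \<sigma> :: "nat \<Rightarrow> nat"
  assumes "\<sigma> permutes {..<b}" "\<sigma> \<noteq> id"
  shows "(\<Sum>i<b. (r + i) * (c + \<sigma> i)) < (\<Sum>i<b. (r + i) * (c + i))"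
proof -
  have perm: "(\<Sum>i<b. f (\<sigma> i)) = (\<Sum>i<b. f i)" for f :: "nat \<Rightarrow> int"
    using sum.permute[OF assms(1), of f] by (simp add: o_def)
  obtain j where j: "\<sigma> j \<noteq> j" using assms(2) by (auto simp: fun_eq_iff)
  then have jb: "j < b" using assms(1) by (auto simp: permutes_def)
  have "(\<Sum>i<b. (int (\<sigma> i) - int i) ^ 2) > 0"
    using j jb by (intro sum_pos2[of _ j]) auto
  also have "(\<Sum>i<b. (int (\<sigma> i) - int i) ^ 2) = (\<Sum>i<b. int (\<sigma> i) ^ 2) + (\<Sum>i<b. int i ^ 2) - 2 * (\<Sum>i<b. int i * int (\<sigma> i))"
    by (simp add: power2_diff sum.distrib sum_subtractf sum_distrib_left mult_ac)
  also have "(\<Sum>i<b. int (\<sigma> i) ^ 2) = (\<Sum>i<b. int i ^ 2)" by (rule perm)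
  finally have "(\<Sum>i<b. int i * int (\<sigma> i)) < (\<Sum>i<b. int i ^ 2)" by simp
  moreover have "(\<Sum>i<b. (int r + int i) * (int c + int (\<sigma> i))) =
      (\<Sum>i<b. int r * int c) + (\<Sum>i<b. int r * int (\<sigma> i)) + (\<Sum>i<b. int i * int c) + (\<Sum>i<b. int i * int (\<sigma> i))"
    by (simp add: algebra_simps sum.distrib)
  moreover have "(\<Sum>i<b. int r * int (\<sigma> i)) = (\<Sum>i<b. int r * int i)" by (rule perm)
  moreover have "(\<Sum>i<b. (int r + int i) * (int c + int i)) =
      (\<Sum>i<b. int r * int c) + (\<Sum>i<b. int r * int i) + (\<Sum>i<b. int i * int c) + (\<Sum>i<b. int i ^ 2)"
    by (simp add: algebra_simps sum.distrib power2_eq_square)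
  ultimately have "(\<Sum>i<b. (int r + int i) * (int c + int (\<sigma> i))) < (\<Sum>i<b. (int r + int i) * (int c + int i))"
    by linarith
  then have "int (\<Sum>i<b. (r + i) * (c + \<sigma> i)) < int (\<Sum>i<b. (r + i) * (c + i))"
    by simp
  then show ?thesis by (simp only: of_nat_less_iff)
qed

lemma has_lead_minor:
  "has_lead (minor b (\<lambda>i. r + i) (\<lambda>i. c + i) :: 'a::comm_ring_1 mpoly) (\<Sum>i<b. Poly_Mapping.single (r + i, c + i) 1)"
proof -
  define M where "M \<sigma> = (\<Sum>i<b. Poly_Mapping.single (r + i, c + \<sigma> i) (1::nat))" for \<sigma>
  define g :: "'a mpoly" where "g = (\<Sum>\<sigma> \<in> {\<sigma>. \<sigma> permutes {..<b}} - {id}. of_int (sign \<sigma>) * Poly_Mapping.single (M \<sigma>) 1)"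
  have "minor b (\<lambda>i. r + i) (\<lambda>i. c + i) = (\<Sum>\<sigma> | \<sigma> permutes {..<b}. of_int (sign \<sigma>) * Poly_Mapping.single (M \<sigma>) (1::'a))"
    unfolding minor_def M_def prod_var ..
  also have "\<dots> = Poly_Mapping.single (M id) 1 + g"
    unfolding g_def by (subst sum.remove[of _ id]) (auto simp: permutes_id finite_permutations)
  finally have "minor b (\<lambda>i. r + i) (\<lambda>i. c + i) = Poly_Mapping.single (M id) 1 + g" .
  moreover have "wt \<mu> < wt (M id)" if "\<mu> \<in> Poly_Mapping.keys g" for \<mu>
  proof -
    from that obtain \<sigma> where \<sigma>: "\<sigma> permutes {..<b}" "\<sigma> \<noteq> id"
      "\<mu> \<in> Poly_Mapping.keys (of_int (sign \<sigma>) * Poly_Mapping.single (M \<sigma>) (1::'a))"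
      unfolding g_def using keys_sum_subset by fast
    have "of_int (sign \<sigma>) * Poly_Mapping.single (M \<sigma>) (1::'a) = Poly_Mapping.single (M \<sigma>) (of_int (sign \<sigma>))"
      by (simp add: single_of_int[symmetric] mult_single del: single_of_int)
    with \<sigma>(3) have "\<mu> = M \<sigma>" by (auto split: if_splits)
    then show ?thesis
      using sum_mult_permutes_less[OF \<sigma>(1,2), of r c] by (simp add: M_def wt_sum)
  qed
  ultimately show ?thesis unfolding has_lead_def M_def by (intro exI[of _ g]) simp
qed

text \<open>Each diagonal i - j = const is labelled by its only cell in the first row or first
  column.\<close>

definition diag_starts :: "nat \<Rightarrow> nat \<Rightarrow> (nat \<times> nat) set" where
  "diag_starts m n = {(r, c). r < m \<and> c < n \<and> (r = 0 \<or> c = 0)}"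

definition diag_len :: "nat \<Rightarrow> nat \<Rightarrow> nat \<times> nat \<Rightarrow> nat" where
  "diag_len m n s = min (m - fst s) (n - snd s)"

lemma finite_diag_starts: "finite (diag_starts m n)"
  by (rule finite_subset[of _ "{..<m} \<times> {..<n}"]) (auto simp: diag_starts_def)

text \<open>The position of (i, j) on its diagonal is min i j, so cutting off k positions everywhere
  leaves the cells with both coordinates at least k. General k yields the count of cells, k = 0 the
  leading monomial.\<close>

lemma bij_betw_diagonals:
  "bij_betw (\<lambda>(s, i). (fst s + i, snd s + i))
     (SIGMA s:diag_starts m n. {k..<diag_len m n s}) ({k..<m} \<times> {k..<n})"
  by (rule bij_betw_byWitness[where f' = "\<lambda>(i, j). ((i - min i j, j - min i j), min i j)"])
     (auto simp: diag_starts_def diag_len_def min_def split: if_splits)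

lemma sum_diag_len:
  "(\<Sum>s\<in>diag_starts m n. diag_len m n s - k) = (m - k) * (n - k)"
  using bij_betw_same_card[OF bij_betw_diagonals[of m n k]]
  by (simp add: card_SigmaI finite_diag_starts)

definition diag_prod :: "nat \<Rightarrow> nat \<Rightarrow> 'a::comm_ring_1 mpoly" where
  "diag_prod m n = (\<Prod>s\<in>diag_starts m n. minor (diag_len m n s) (\<lambda>i. fst s + i) (\<lambda>i. snd s + i))"

lemma has_lead_diag_prod:
  "has_lead (diag_prod m n) (\<Sum>p\<in>{..<m} \<times> {..<n}. Poly_Mapping.single p 1)"
proof -
  have "(\<Sum>p\<in>{0..<m} \<times> {0..<n}. Poly_Mapping.single p 1) =
      (\<Sum>x\<in>(SIGMA s:diag_starts m n. {0..<diag_len m n s}).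
        Poly_Mapping.single (case x of (s, i) \<Rightarrow> (fst s + i, snd s + i)) (1::nat))"
    by (rule sum.reindex_bij_betw[OF bij_betw_diagonals, symmetric])
  also have "\<dots> = (\<Sum>s\<in>diag_starts m n. \<Sum>i<diag_len m n s. Poly_Mapping.single (fst s + i, snd s + i) 1)"
    by (subst sum.Sigma) (auto simp: finite_diag_starts atLeast0LessThan intro!: sum.cong)
  finally show ?thesis
    unfolding diag_prod_def using has_lead_prod[OF has_lead_minor]
    by (simp add: atLeast0LessThan)
qed

lemma diag_prod_mem:
  "diag_prod m n \<in> (\<Prod>s\<in>diag_starts m n. mnrs var m n (diag_len m n s))"
  unfolding diag_prod_def
  by (rule prod_mem_set_prod[OF finite_diag_starts])
     (auto simp: minor_eq_mnr diag_starts_def diag_len_def intro!: mnr_mem_mnrs)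

text \<open>Balancing is applied to N copies of the multiset of diagonal lengths, for which its
  hypothesis is the one here by \<open>sum_diag_len\<close>.\<close>

lemma diag_prod_power_asymp:
  assumes "t > 0" "\<And>k. k < t \<Longrightarrow> s * (t - k) \<le> N * ((m - k) * (n - k))"
  obtains h where "\<And>l. (diag_prod m n :: 'a::comm_ring_1 mpoly) ^ (N * (l + h)) \<in> idl.span (mnrs var m n t ^ (s * l))"
proof -
  define S where "S = repeat_mset N (image_mset (diag_len m n) (mset_set (diag_starts m n)))"
  have sum_rep: "(\<Sum>b\<in>#repeat_mset N S'. b - k) = N * (\<Sum>b\<in>#S'. b - k)" for S' and k :: nat
    by (induction N) (simp_all add: sum_mset.distrib image_mset.compositionality o_def)
  have prod_rep: "(\<Prod>b\<in>#repeat_mset N S'. f b) = (\<Prod>b\<in>#S'. f b) ^ N" for S' and f :: "nat \<Rightarrow> 'a mpoly set"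
    by (induction N) (auto simp: mult.commute)
  have "(\<Prod>b\<in>#S. mnrs (var :: nat \<Rightarrow> nat \<Rightarrow> 'a mpoly) m n b) \<preceq>\<^sub>a mnrs var m n t ^ s"
  proof (rule prod_mnrs_asymp_in[OF assms(1)])
    fix k assume "k < t"
    have "(\<Sum>b\<in>#S. b - k) = N * ((m - k) * (n - k))"
      unfolding S_def sum_rep sum_diag_len[symmetric] by (simp add: image_mset.compositionality o_def sum_unfold_sum_mset)
    with assms(2)[OF \<open>k < t\<close>] show "s * (t - k) \<le> (\<Sum>b\<in>#S. b - k)" by simp
  qed
  then obtain h where h: "\<And>l. (\<Prod>b\<in>#S. mnrs (var :: nat \<Rightarrow> nat \<Rightarrow> 'a mpoly) m n b) ^ (l + h)
      \<subseteq> idl.span ((mnrs var m n t ^ s) ^ l)"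
    unfolding asymp_in_def by blast
  have S: "(\<Prod>b\<in>#S. mnrs (var :: nat \<Rightarrow> nat \<Rightarrow> 'a mpoly) m n b) =
      (\<Prod>s\<in>diag_starts m n. mnrs var m n (diag_len m n s)) ^ N"
    unfolding S_def prod_rep by (simp add: image_mset.compositionality o_def prod_unfold_prod_mset)
  show ?thesis
  proof (rule that[of h])
    fix l
    have "(diag_prod m n :: 'a mpoly) ^ (N * (l + h)) \<in> (\<Prod>b\<in>#S. mnrs var m n b) ^ (l + h)"
      unfolding S power_mult by (intro power_mem_set_power diag_prod_mem)
    with h[of l] show "(diag_prod m n :: 'a mpoly) ^ (N * (l + h)) \<in> idl.span (mnrs var m n t ^ (s * l))"
      by (auto simp: power_mult)
  qed
qed

section \<open>Reduction to a Schur complement\<close>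

lemma mnr_scale_rows:
  "mnr (\<lambda>i j. c i * x i j) t \<alpha> \<gamma> = (\<Prod>i<t. c (\<alpha> i)) * mnr x t \<alpha> \<gamma>"
  unfolding mnr_eq_sum by (simp add: prod.distrib sum_distrib_left mult_ac)

text \<open>Multilinearity: f records the summand taken by each row. That choice depends on the
  position of the row, not on its index \<alpha> i, hence the absorbed index functions and the
  \<open>id\<close>.\<close>

lemma mnr_sum_rows:
  assumes "finite C"
  shows "mnr (\<lambda>i j. \<Sum>c\<in>C. V c i j) t \<alpha> \<gamma> =
    (\<Sum>f\<in>{..<t} \<rightarrow>\<^sub>E C. mnr (\<lambda>i j. V (f i) (\<alpha> i) (\<gamma> j)) t id id)"
  unfolding mnr_eq_sum
  by (subst prod_sum_PiE) (use assms in \<open>auto simp: sum_distrib_left intro: sum.swap\<close>)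

lemma prod_mem_span_power:
  assumes "finite I" "J \<subseteq> I" "\<And>i. i \<in> J \<Longrightarrow> f i \<in> idl.span S"
  shows "(\<Prod>i\<in>I. f i) \<in> idl.span (S ^ card J)"
proof -
  have "finite J" using assms(1,2) finite_subset by blast
  then have "(\<Prod>i\<in>J. f i) \<in> idl.span (S ^ card J)"
    using assms(3)
  proof (induction J rule: finite_induct)
    case (insert x J)
    then show ?case using mult_mem_span[of "f x" S "prod f J" "S ^ card J"] by simp
  qed (simp add: span_one)
  then show ?thesis
    unfolding prod.subset_diff[OF assms(2,1)] by (rule span_mult_left)
qed

text \<open>In the multilinear expansion, a term taking two rows from the same rank-one summand of
  \<open>P Q\<close> vanishes, so at most \<open>k\<close> rows come from \<open>P Q\<close>.\<close>

lemma mnr_low_rank_mem: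
  fixes Y P Q :: "nat \<Rightarrow> nat \<Rightarrow> 'b::comm_ring_1"
  assumes "\<And>i j. i < t \<Longrightarrow> j < t \<Longrightarrow> Y (\<alpha> i) (\<gamma> j) \<in> idl.span S"
  shows "mnr (\<lambda>i j. Y i j + (\<Sum>b<k. P i b * Q b j)) t \<alpha> \<gamma> \<in> idl.span (S ^ (t - k))"
proof -
  define V where "V c i j = (if c = k then Y i j else P i c * Q c j)" for c i j
  have "(\<Sum>b<k. V b i j) = (\<Sum>b<k. P i b * Q b j)" for i j
    by (rule sum.cong) (auto simp: V_def)
  then have "(\<lambda>i j. Y i j + (\<Sum>b<k. P i b * Q b j)) = (\<lambda>i j. \<Sum>c\<in>{..k}. V c i j)"
    by (auto simp: fun_eq_iff lessThan_Suc_atMost[symmetric] V_def[of k] add.commute)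
  moreover have "mnr (\<lambda>i j. V (f i) (\<alpha> i) (\<gamma> j)) t id id \<in> idl.span (S ^ (t - k))"
    if f: "f \<in> {..<t} \<rightarrow>\<^sub>E {..k}" for f
  proof (cases "\<exists>i<t. \<exists>i'<t. i \<noteq> i' \<and> f i = f i' \<and> f i \<noteq> k")
    case True
    then obtain i i' where i: "i < t" "i' < t" "i \<noteq> i'" "f i = f i'" "f i \<noteq> k" by blast
    \<comment> \<open>Once the scalars \<open>c\<close> are pulled out of the rows, rows i and i' of
      \<open>X\<close> are both row f i of \<open>Q\<close>.\<close>
    define c where "c l = (if f l = k then 1 else P (\<alpha> l) (f l))" for l
    define X where "X l j = (if f l = k then Y (\<alpha> l) (\<gamma> j) else Q (f l) (\<gamma> j))" for l j
    have "(\<lambda>i j. V (f i) (\<alpha> i) (\<gamma> j)) = (\<lambda>i j. c i * X i j)"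
      by (auto simp: V_def c_def X_def)
    moreover have "mnr X t id id = 0"
      unfolding mnr_def
    proof (rule Determinant.det_identical_rows[of _ t i i'])
      show "Matrix.row (Matrix.mat t t (\<lambda>(i, j). X (id i) (id j))) i =
          Matrix.row (Matrix.mat t t (\<lambda>(i, j). X (id i) (id j))) i'"
        using i by (intro eq_vecI) (auto simp: X_def)
    qed (use i in auto)
    ultimately show ?thesis by (simp add: mnr_scale_rows idl.span_zero)
  next
    case False
    define J where "J = {i. i < t \<and> f i = k}"
    have "inj_on f ({..<t} - J)" using False by (auto simp: inj_on_def J_def)
    moreover have "f ` ({..<t} - J) \<subseteq> {..<k}"
    proof
      fix y assume "y \<in> f ` ({..<t} - J)"
      then obtain i where "i < t" "f i \<noteq> k" "y = f i" by (auto simp: J_def)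
      with f show "y \<in> {..<k}" by (force simp: PiE_iff)
    qed
    ultimately have "card ({..<t} - J) \<le> card {..<k}" by (rule card_inj_on_le) simp
    moreover have J: "J \<subseteq> {..<t}" by (auto simp: J_def)
    ultimately have "t - k \<le> card J" by (simp add: card_Diff_subset finite_subset)
    have "(\<Prod>i<t. V (f (id i)) (\<alpha> (id i)) (\<gamma> (id (\<sigma> i)))) \<in> idl.span (S ^ card J)"
      if "\<sigma> permutes {..<t}" for \<sigma>
    proof (rule prod_mem_span_power[OF _ J])
      fix i assume "i \<in> J"
      moreover from this have "\<sigma> i < t" using permutes_in_image[OF that, of i] by (auto simp: J_def)
      ultimately show "V (f (id i)) (\<alpha> (id i)) (\<gamma> (id (\<sigma> i))) \<in> idl.span S"
        using assms[of i "\<sigma> i"] by (auto simp: J_def V_def)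
    qed simp
    then have "mnr (\<lambda>i j. V (f i) (\<alpha> i) (\<gamma> j)) t id id \<in> idl.span (S ^ card J)"
      unfolding mnr_eq_sum by (intro idl.span_sum span_mult_left) auto
    then show ?thesis using span_power_antimono[OF \<open>t - k \<le> card J\<close>] by blast
  qed
  ultimately show ?thesis
    by (simp only: mnr_sum_rows[OF finite_atMost]) (rule idl.span_sum)
qed

text \<open>With B the adjugate of the leading k-block A, Y = \<delta> x - (x B) x is a Schur
  complement free of denominators. It vanishes in the first k rows and columns because A B = B A =
  \<delta>. So \<delta> x is Y plus a matrix of the form P Q with inner dimension k, and \<delta>^t
  comes from scaling t rows. One set S serves all t, \<alpha> and \<gamma>.\<close>

lemma mnr_schur_mem:
  fixes x :: "nat \<Rightarrow> nat \<Rightarrow> 'b::comm_ring_1"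
  assumes base: "\<And>i j. i < m \<Longrightarrow> j < n \<Longrightarrow> k \<le> i \<or> k \<le> j \<Longrightarrow> x i j \<in> idl.span Z"
  shows "\<exists>S. finite S \<and> card S \<le> (m - k) * (n - k) \<and> S \<subseteq> idl.span Z \<and>
    (\<forall>t \<alpha> \<gamma>. \<alpha> \<in> {..<t} \<rightarrow> {..<m} \<longrightarrow> \<gamma> \<in> {..<t} \<rightarrow> {..<n} \<longrightarrow>
       mnr x k id id ^ t * mnr x t \<alpha> \<gamma> \<in> idl.span (S ^ (t - k)))"
proof -
  define A where "A = Matrix.mat k k (\<lambda>(i, j). x i j)"
  define \<delta> where "\<delta> = mnr x k id id"
  have \<delta>: "\<delta> = Determinant.det A" by (simp add: \<delta>_def A_def mnr_def)
  have A: "A \<in> carrier_mat k k" by (simp add: A_def)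
  note adj = adj_mat[OF A]
  define B where "B i j = adj_mat A $$ (i, j)" for i j
  have AB: "(\<Sum>a<k. x i a * B a j) = (if i = j then \<delta> else 0)" if "i < k" "j < k" for i j
  proof -
    have "(A * adj_mat A) $$ (i, j) = (\<Sum>a<k. x i a * B a j)"
      using that adj(1) A by (auto simp: scalar_prod_def A_def B_def atLeast0LessThan intro!: sum.cong)
    moreover have "(A * adj_mat A) $$ (i, j) = (if i = j then \<delta> else 0)"
      using that by (simp add: adj(2) \<delta>)
    ultimately show ?thesis by simp
  qed
  have BA: "(\<Sum>a<k. B i a * x a j) = (if i = j then \<delta> else 0)" if "i < k" "j < k" for i j
  proof -
    have "(adj_mat A * A) $$ (i, j) = (\<Sum>a<k. B i a * x a j)"
      using that adj(1) A by (auto simp: scalar_prod_def A_def B_def atLeast0LessThan intro!: sum.cong)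
    moreover have "(adj_mat A * A) $$ (i, j) = (if i = j then \<delta> else 0)"
      using that by (simp add: adj(3) \<delta>)
    ultimately show ?thesis by simp
  qed
  define P where "P i b = (\<Sum>a<k. x i a * B a b)" for i b
  define Y where "Y i j = \<delta> * x i j - (\<Sum>b<k. P i b * x b j)" for i j
  have Y0: "Y i j = 0" if "i < k" for i j
  proof -
    have "(\<Sum>b<k. P i b * x b j) = (\<Sum>b<k. if i = b then \<delta> * x b j else 0)"
      using that by (intro sum.cong) (auto simp: P_def AB)
    then show ?thesis using that by (simp add: Y_def)
  qed
  have Y0': "Y i j = 0" if "j < k" for i j
  proof -
    have "(\<Sum>b<k. P i b * x b j) = (\<Sum>b<k. \<Sum>a<k. x i a * (B a b * x b j))"
      unfolding P_def by (simp add: sum_distrib_right mult.assoc)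
    also have "\<dots> = (\<Sum>a<k. x i a * (\<Sum>b<k. B a b * x b j))"
      by (subst sum.swap) (simp add: sum_distrib_left)
    also have "\<dots> = (\<Sum>a<k. if a = j then \<delta> * x i a else 0)"
      using that by (intro sum.cong) (auto simp: BA)
    finally show ?thesis using that by (simp add: Y_def)
  qed
  have YZ: "Y i j \<in> idl.span Z" if "i < m" "j < n" "k \<le> i" "k \<le> j" for i j
    unfolding Y_def
  proof (intro idl.span_diff idl.span_sum)
    show "\<delta> * x i j \<in> idl.span Z" using that by (intro span_mult_left base) auto
    fix b assume "b \<in> {..<k}"
    then show "P i b * x b j \<in> idl.span Z" using that by (intro span_mult_left base) auto
  qed
  define S where "S = (\<lambda>(i, j). Y i j) ` ({k..<m} \<times> {k..<n})"
  show ?thesis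
  proof (intro exI[of _ S] conjI allI impI)
    show "finite S" by (simp add: S_def)
    have "card S \<le> card ({k..<m} \<times> {k..<n})" unfolding S_def by (rule card_image_le) simp
    then show "card S \<le> (m - k) * (n - k)" by simp
    show "S \<subseteq> idl.span Z" using YZ by (auto simp: S_def)
    fix t :: nat and \<alpha> \<gamma> :: "nat \<Rightarrow> nat" assume \<alpha>: "\<alpha> \<in> {..<t} \<rightarrow> {..<m}" and \<gamma>: "\<gamma> \<in> {..<t} \<rightarrow> {..<n}"
    have "mnr (\<lambda>i j. Y i j + (\<Sum>b<k. P i b * x b j)) t \<alpha> \<gamma> \<in> idl.span (S ^ (t - k))"
    proof (rule mnr_low_rank_mem)
      fix i j assume "i < t" "j < t"
      then have "\<alpha> i < m" "\<gamma> j < n" using \<alpha> \<gamma> by auto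
      then show "Y (\<alpha> i) (\<gamma> j) \<in> idl.span S"
      proof (cases "\<alpha> i < k \<or> \<gamma> j < k")
        case True
        then show ?thesis by (auto simp: Y0 Y0' idl.span_zero)
      next
        case False
        with \<open>\<alpha> i < m\<close> \<open>\<gamma> j < n\<close> show ?thesis by (auto simp: S_def intro!: idl.span_base)
      qed
    qed
    then show "mnr x k id id ^ t * mnr x t \<alpha> \<gamma> \<in> idl.span (S ^ (t - k))"
      unfolding \<delta>_def[symmetric] by (simp add: Y_def mnr_scale_rows)
  qed
qed

text \<open>Pigeonhole: if each element of S occurred at most q - 1 times, there would be at most
  card S * (q - 1) factors.\<close>

lemma set_power_subset_span_powers:
  fixes S :: "'b::comm_ring_1 set"
  assumes "finite S" "card S * (q - 1) < N"
  shows "S ^ N \<subseteq> idl.span ((\<lambda>y. y ^ q) ` S)"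
proof
  fix x assume "x \<in> S ^ N"
  then obtain xs where xs: "length xs = N" "set xs \<subseteq> S" "x = prod_list xs"
    by (auto simp: set_power_iff_prod_list)
  have "\<exists>y\<in>set xs. q \<le> count (mset xs) y"
  proof (rule ccontr)
    assume "\<not> ?thesis"
    then have "count (mset xs) y \<le> q - 1" if "y \<in> set xs" for y using that by force
    then have "(\<Sum>y\<in>set xs. count (mset xs) y) \<le> card (set xs) * (q - 1)"
      using sum_bounded_above[of "set xs" "count (mset xs)" "q - 1"] by simp
    also have "\<dots> \<le> card S * (q - 1)" using xs(2) assms(1) by (intro mult_le_mono1 card_mono)
    finally show False using assms(2) xs(1) by (simp add: size_multiset_overloaded_eq[of "mset xs", symmetric, simplified])
  qed
  then obtain y where y: "y \<in> set xs" "q \<le> count (mset xs) y" by blast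
  have "x = (\<Prod>z\<in>set xs. z ^ count (mset xs) z)"
    unfolding xs(3) by (metis prod_mset_multiplicity prod_mset_prod_list set_mset_mset)
  also have "\<dots> = y ^ count (mset xs) y * (\<Prod>z\<in>set xs - {y}. z ^ count (mset xs) z)"
    using y(1) by (subst prod.remove[of _ y]) auto
  also have "y ^ count (mset xs) y = y ^ (count (mset xs) y - q) * y ^ q"
    using y(2) by (simp add: power_add[symmetric])
  finally have "x = (y ^ (count (mset xs) y - q) * (\<Prod>z\<in>set xs - {y}. z ^ count (mset xs) z)) * y ^ q"
    by (simp add: mult_ac)
  moreover have "y ^ q \<in> (\<lambda>y. y ^ q) ` S" using y(1) xs(2) by auto
  ultimately show "x \<in> idl.span ((\<lambda>y. y ^ q) ` S)"
    by (simp add: span_mult_left idl.span_base)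
qed

lemma prod_diff_mem_span:
  assumes "\<And>i. i \<in> A \<Longrightarrow> f i - g i \<in> idl.span S"
  shows "(\<Prod>i\<in>A. f i) - (\<Prod>i\<in>A. g i) \<in> idl.span S"
  using assms
proof (induction A rule: infinite_finite_induct)
  case (insert x A)
  have "prod f A - prod g A \<in> idl.span S" using insert by auto
  then have "f x * (prod f A - prod g A) + prod g A * (f x - g x) \<in> idl.span S"
    using insert.prems by (intro idl.span_add span_mult_left) auto
  then show ?case using insert by (simp add: algebra_simps)
qed (auto simp: idl.span_zero)

lemma mnr_diff_mem_span:
  assumes "\<And>i j. i < t \<Longrightarrow> j < t \<Longrightarrow> x (\<alpha> i) (\<gamma> j) - x' (\<alpha> i) (\<gamma> j) \<in> idl.span S"
  shows "mnr x t \<alpha> \<gamma> - mnr x' t \<alpha> \<gamma> \<in> idl.span S"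
  unfolding mnr_eq_sum sum_subtractf[symmetric] right_diff_distrib[symmetric]
proof (rule idl.span_sum, rule span_mult_left, rule prod_diff_mem_span)
  fix \<sigma> i assume "\<sigma> \<in> {\<sigma>. \<sigma> permutes {..<t}}" "i \<in> {..<t}"
  moreover from this have "\<sigma> i < t" using permutes_in_image[of \<sigma> "{..<t}" i] by auto
  ultimately show "x (\<alpha> i) (\<gamma> (\<sigma> i)) - x' (\<alpha> i) (\<gamma> (\<sigma> i)) \<in> idl.span S"
    using assms by auto
qed

lemma mnr_scalar: "mnr (\<lambda>i j. if i = j then s else 0) k id id = (s :: 'b::comm_ring_1) ^ k"
proof -
  have "Matrix.mat k k (\<lambda>(i, j). if id i = id j then s else 0) = s \<cdot>\<^sub>m 1\<^sub>m k"
    by (intro eq_matI) auto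
  then show ?thesis by (simp add: mnr_def)
qed

section \<open>Frobenius powers of the maximal ideal\<close>

abbreviation vars :: "nat \<Rightarrow> nat \<Rightarrow> 'a::comm_ring_1 mpoly set" where
  "vars m n \<equiv> {var i j | i j. i < m \<and> j < n}"

section \<open>The Frobenius power as a monomial ideal\<close>

lemma mpoly_sum_monomials:
  "(f :: 'a::comm_ring_1 mpoly) = (\<Sum>\<mu>\<in>Poly_Mapping.keys f. Poly_Mapping.single \<mu> (Poly_Mapping.lookup f \<mu>))"
  by (rule poly_mapping_eqI) (auto simp: lookup_sum lookup_single when_def in_keys_iff)

lemma lookup_single_mult:
  fixes f :: "'a::comm_ring_1 mpoly"
  shows "Poly_Mapping.lookup (Poly_Mapping.single \<mu> 1 * f) (\<mu> + \<nu>) = Poly_Mapping.lookup f \<nu>"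
proof -
  have "Poly_Mapping.single \<mu> 1 * f =
      (\<Sum>\<nu>\<in>Poly_Mapping.keys f. Poly_Mapping.single (\<mu> + \<nu>) (Poly_Mapping.lookup f \<nu>))"
    by (subst mpoly_sum_monomials[of f]) (simp add: sum_distrib_left mult_single)
  then show ?thesis by (auto simp: lookup_sum lookup_single when_def in_keys_iff)
qed

lemma var_power: "var i j ^ q = Poly_Mapping.single (Poly_Mapping.single (i, j) q) 1"
proof (induction q)
  case (Suc q)
  then show ?case by (simp add: var_def mult_single single_add[symmetric])
qed simp

text \<open>The ideal is monomial, so membership is decided term by term. Both halves rely on this:
  a single monomial shows non-membership, and a power of an indeterminate outside the range can be
  cancelled.\<close>

lemma mem_span_var_powers_iff:
  fixes f :: "'a::comm_ring_1 mpoly"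
  shows "f \<in> idl.span ((\<lambda>y. y ^ q) ` vars m n) \<longleftrightarrow>
    (\<forall>\<mu>\<in>Poly_Mapping.keys f. \<exists>i<m. \<exists>j<n. q \<le> Poly_Mapping.lookup \<mu> (i, j))" (is "_ \<longleftrightarrow> ?R f")
proof
  assume "f \<in> idl.span ((\<lambda>y. y ^ q) ` vars m n)"
  then show "?R f"
  proof (induction rule: idl.span_induct_alt)
    case (step c x y)
    from step(1) obtain i j where ij: "i < m" "j < n" "x = Poly_Mapping.single (Poly_Mapping.single (i, j) q) 1"
      by (auto simp: var_power)
    show ?case
    proof
      fix \<mu> assume "\<mu> \<in> Poly_Mapping.keys (c * x + y)"
      then consider "\<mu> \<in> Poly_Mapping.keys (c * x)" | "\<mu> \<in> Poly_Mapping.keys y"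
        using Poly_Mapping.keys_add[of "c * x" y] by blast
      then show "\<exists>i<m. \<exists>j<n. q \<le> Poly_Mapping.lookup \<mu> (i, j)"
      proof cases
        case 1
        then obtain a b where *: "\<mu> = a + b" "b \<in> Poly_Mapping.keys x"
          using keys_mult[of c x] by blast
        then have "q \<le> Poly_Mapping.lookup \<mu> (i, j)"
          by (auto simp: ij(3) lookup_add split: if_splits)
        then show ?thesis using ij(1,2) by blast
      qed (use step(2) in blast)
    qed
  qed simp
next
  assume R: "?R f"
  show "f \<in> idl.span ((\<lambda>y. y ^ q) ` vars m n)"
  proof (subst mpoly_sum_monomials, rule idl.span_sum)
    fix \<mu> assume "\<mu> \<in> Poly_Mapping.keys f"
    with R obtain i j where ij: "i < m" "j < n" "q \<le> Poly_Mapping.lookup \<mu> (i, j)" by blast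
    have "\<mu> = (\<mu> - Poly_Mapping.single (i, j) q) + Poly_Mapping.single (i, j) q"
      by (rule poly_mapping_eqI) (use ij(3) in \<open>auto simp: lookup_add lookup_minus lookup_single when_def\<close>)
    then have "Poly_Mapping.single \<mu> (Poly_Mapping.lookup f \<mu>) =
        Poly_Mapping.single (\<mu> - Poly_Mapping.single (i, j) q) (Poly_Mapping.lookup f \<mu>) * var i j ^ q"
      by (simp add: var_power mult_single)
    moreover have "var i j ^ q \<in> idl.span ((\<lambda>y. y ^ q) ` (vars m n :: 'a mpoly set))"
      using ij(1,2) by (intro idl.span_base) auto
    ultimately show "Poly_Mapping.single \<mu> (Poly_Mapping.lookup f \<mu>) \<in> idl.span ((\<lambda>y. y ^ q) ` vars m n)"
      by (simp add: span_mult_left)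
  qed
qed

lemma CHAR_mpoly: "CHAR('a::comm_ring_1 mpoly) = CHAR('a)"
proof (rule CHAR_eqI)
  have *: "of_nat k = (0 :: 'a mpoly) \<longleftrightarrow> of_nat k = (0 :: 'a)" for k
    using inj_eq[OF inj_single, of "0 :: nat \<times> nat \<Rightarrow>\<^sub>0 nat" "of_nat k :: 'a" 0]
    by (simp only: single_of_nat single_zero)
  show "of_nat CHAR('a) = (0 :: 'a mpoly)" by (simp add: *)
  show "CHAR('a) dvd k" if "of_nat k = (0 :: 'a mpoly)" for k
    using that by (simp add: * of_nat_eq_0_iff_char_dvd)
qed

lemma power_mem_span_powers:
  fixes a :: "'b::comm_ring_1"
  assumes "prime CHAR('b)" "q = CHAR('b) ^ e" "a \<in> idl.span Z"
  shows "a ^ q \<in> idl.span ((\<lambda>y. y ^ q) ` Z)"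
proof -
  from assms(3) obtain F c where F: "finite F" "F \<subseteq> Z" "a = (\<Sum>s\<in>F. c s * s)"
    by (auto simp: idl.span_explicit)
  have "a ^ q = (\<Sum>s\<in>F. c s ^ q * s ^ q)"
    unfolding F(3) by (simp add: freshmans_dream_sum'[OF assms(1,2)] power_mult_distrib)
  also have "\<dots> \<in> idl.span ((\<lambda>y. y ^ q) ` Z)"
    by (rule idl.span_sum, rule span_mult_left, rule idl.span_base) (use F(2) in blast)
  finally show ?thesis .
qed

text \<open>The q-th power map is additive in characteristic p, so the q-th powers of generators
  already generate.\<close>

lemma frob_pow_max_ideal:
  assumes "prime CHAR('a::comm_ring_1)" "q = CHAR('a) ^ e"
  shows "frob_pow (max_ideal m n :: 'a mpoly set) q = idl.span ((\<lambda>y. y ^ q) ` vars m n)"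
proof
  show "frob_pow (max_ideal m n :: 'a mpoly set) q \<subseteq> idl.span ((\<lambda>y. y ^ q) ` vars m n)"
    unfolding frob_pow_def max_ideal_def gen_ideal_eq_span span_subset_iff
    using power_mem_span_powers[where ?'b = "'a mpoly", unfolded CHAR_mpoly, OF assms] by blast
  show "idl.span ((\<lambda>y. y ^ q) ` vars m n) \<subseteq> frob_pow (max_ideal m n :: 'a mpoly set) q"
    unfolding frob_pow_def max_ideal_def gen_ideal_eq_span
    by (rule idl.span_mono) (auto intro: idl.span_base)
qed

lemma lookup_keys_prod_eq_0:
  fixes f :: "nat \<Rightarrow> 'a::comm_ring_1 mpoly"
  assumes "\<And>i. i \<in> A \<Longrightarrow> \<forall>\<mu>\<in>Poly_Mapping.keys (f i). Poly_Mapping.lookup \<mu> v = 0"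
  shows "\<forall>\<mu>\<in>Poly_Mapping.keys (\<Prod>i\<in>A. f i). Poly_Mapping.lookup \<mu> v = 0"
  using assms
proof (induction A rule: infinite_finite_induct)
  case (insert x A)
  show ?case
  proof
    fix \<mu> assume "\<mu> \<in> Poly_Mapping.keys (prod f (insert x A))"
    then obtain a b where "a \<in> Poly_Mapping.keys (f x)" "b \<in> Poly_Mapping.keys (prod f A)" "\<mu> = a + b"
      using keys_mult[of "f x" "prod f A"] insert by auto
    then show "Poly_Mapping.lookup \<mu> v = 0" using insert by (auto simp: lookup_add)
  qed
qed auto

lemma lookup_keys_mnr_var:
  assumes "\<alpha> \<in> {..<t} \<rightarrow> {..<m}" "\<mu> \<in> Poly_Mapping.keys (mnr var t \<alpha> \<gamma> :: 'a::comm_ring_1 mpoly)"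
  shows "Poly_Mapping.lookup \<mu> (m, n) = 0"
proof -
  from assms(2) obtain \<sigma> where "\<mu> \<in> Poly_Mapping.keys (of_int (sign \<sigma>) * (\<Prod>i<t. var (\<alpha> i) (\<gamma> (\<sigma> i)) :: 'a mpoly))"
    unfolding mnr_eq_sum using keys_sum_subset by fast
  then obtain a b where ab: "a \<in> Poly_Mapping.keys (of_int (sign \<sigma>) :: 'a mpoly)"
    "b \<in> Poly_Mapping.keys (\<Prod>i<t. var (\<alpha> i) (\<gamma> (\<sigma> i)) :: 'a mpoly)" "\<mu> = a + b"
    using keys_mult by blast
  have "a = 0" using ab(1) by (simp add: single_of_int[symmetric] del: single_of_int split: if_splits)
  moreover have "\<forall>\<mu>\<in>Poly_Mapping.keys (\<Prod>i<t. var (\<alpha> i) (\<gamma> (\<sigma> i)) :: 'a mpoly). Poly_Mapping.lookup \<mu> (m, n) = 0"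
  proof (rule lookup_keys_prod_eq_0, intro ballI)
    fix i \<mu> assume "i \<in> {..<t}" "\<mu> \<in> Poly_Mapping.keys (var (\<alpha> i) (\<gamma> (\<sigma> i)) :: 'a mpoly)"
    moreover from this(1) have "\<alpha> i \<noteq> m" using assms(1) by force
    ultimately show "Poly_Mapping.lookup \<mu> (m, n) = 0"
      by (auto simp: var_def lookup_single when_def split: if_splits)
  qed
  ultimately show ?thesis using ab by (simp add: lookup_add)
qed

text \<open>The spare indeterminate x(m,n) deforms the generic matrix to one whose leading principal
  k-minor becomes a unit once that indeterminate is inverted; specialising it to 0 recovers the
  generic matrix.\<close>

lemma prod_minors_mem_span_powers:
  fixes \<alpha> \<gamma> :: "nat \<Rightarrow> nat \<Rightarrow> nat"
  assumes p: "prime CHAR('a::comm_ring_1)" "q = CHAR('a) ^ e"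
    and k: "k < t" and r: "(m - k) * (n - k) * (q - 1) < (t - k) * r"
    and rg: "\<And>l. l < r \<Longrightarrow> \<alpha> l \<in> {..<t} \<rightarrow> {..<m}" "\<And>l. l < r \<Longrightarrow> \<gamma> l \<in> {..<t} \<rightarrow> {..<n}"
    and km: "k \<le> m" "k \<le> n"
  shows "(\<Prod>l<r. mnr var t (\<alpha> l) (\<gamma> l)) \<in> idl.span ((\<lambda>y. y ^ q) ` (vars m n :: 'a mpoly set))"
proof -
  let ?Z = "vars m n :: 'a mpoly set"
  let ?Zq = "(\<lambda>y. y ^ q) ` ?Z"
  have prime_mpoly: "prime CHAR('a mpoly)" "q = CHAR('a mpoly) ^ e"
    using p by (simp_all add: CHAR_mpoly)
  have q: "q \<ge> 1" using p prime_gt_0_nat[OF p(1)] by simp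
  \<comment> \<open>The polynomial type has an indeterminate for every pair of naturals; x(m,n) lies
    just outside the matrix and hence outside m.\<close>
  define s :: "'a mpoly" where "s = var m n"
  define x :: "nat \<Rightarrow> nat \<Rightarrow> 'a mpoly" where "x i j = var i j + (if i = j \<and> i < k then s else 0)" for i j
  have var_mem: "var i j \<in> idl.span ?Z" if "i < m" "j < n" for i j
    using that by (intro idl.span_base) auto
  have "x i j \<in> idl.span ?Z" if "i < m" "j < n" "k \<le> i \<or> k \<le> j" for i j
    using that var_mem by (auto simp: x_def)
  then have "\<exists>S. finite S \<and> card S \<le> (m - k) * (n - k) \<and> S \<subseteq> idl.span ?Z \<and>
    (\<forall>t \<alpha> \<gamma>. \<alpha> \<in> {..<t} \<rightarrow> {..<m} \<longrightarrow> \<gamma> \<in> {..<t} \<rightarrow> {..<n} \<longrightarrow>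
       mnr x k id id ^ t * mnr x t \<alpha> \<gamma> \<in> idl.span (S ^ (t - k)))"
    by (rule mnr_schur_mem)
  then obtain S where S: "finite S" "card S \<le> (m - k) * (n - k)" "S \<subseteq> idl.span ?Z"
    "\<And>t \<alpha> \<gamma>. \<alpha> \<in> {..<t} \<rightarrow> {..<m} \<longrightarrow> \<gamma> \<in> {..<t} \<rightarrow> {..<n} \<longrightarrow>
       mnr x k id id ^ t * mnr x t \<alpha> \<gamma> \<in> idl.span (S ^ (t - k))"
    by blast
  define \<delta> where "\<delta> = mnr x k id id"
  define F where "F = (\<Prod>l<r. mnr x t (\<alpha> l) (\<gamma> l))"
  define G :: "'a mpoly" where "G = (\<Prod>l<r. mnr var t (\<alpha> l) (\<gamma> l))"
  have "(\<Prod>l<r. \<delta> ^ t * mnr x t (\<alpha> l) (\<gamma> l)) \<in> idl.span ((S ^ (t - k)) ^ card {..<r})"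
    unfolding \<delta>_def by (rule prod_mem_span_power) (use rg S(4) in auto)
  then have "\<delta> ^ (t * r) * F \<in> idl.span (S ^ ((t - k) * r))"
    by (simp add: prod.distrib F_def power_mult)
  moreover have "S ^ ((t - k) * r) \<subseteq> idl.span ((\<lambda>y. y ^ q) ` S)"
  proof (rule set_power_subset_span_powers[OF S(1)])
    have "card S * (q - 1) \<le> (m - k) * (n - k) * (q - 1)" using S(2) by (rule mult_le_mono1)
    also note r
    finally show "card S * (q - 1) < (t - k) * r" .
  qed
  moreover have "(\<lambda>y. y ^ q) ` S \<subseteq> idl.span ?Zq"
    using S(3) power_mem_span_powers[OF prime_mpoly] by blast
  ultimately have "\<delta> ^ (t * r) * F \<in> idl.span ?Zq"
    by (meson span_subset_iff subsetD)
  \<comment> \<open>The exponent is padded to a multiple of q, so that \<delta> enters only through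
    \<delta>^q.\<close>
  then have "\<delta> ^ (q * (t * r) - t * r) * (\<delta> ^ (t * r) * F) \<in> idl.span ?Zq"
    by (rule span_mult_left)
  moreover have "t * r \<le> q * (t * r)" using q by simp
  ultimately have "(\<delta> ^ q) ^ (t * r) * F \<in> idl.span ?Zq"
    by (simp add: mult.assoc[symmetric] power_add[symmetric] power_mult[symmetric])
  \<comment> \<open>Modulo the variables the leading block is s times the identity, so \<delta> is
    s^k modulo m, and Frobenius carries this to m^[q].\<close>
  moreover have "(\<delta> ^ q) ^ (t * r) - (s ^ (k * q)) ^ (t * r) \<in> idl.span ?Zq"
  proof -
    have "\<delta> - mnr (\<lambda>i j. if i = j then s else 0) k id id \<in> idl.span ?Z"
      unfolding \<delta>_def using km by (intro mnr_diff_mem_span) (auto simp: x_def intro!: var_mem)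
    then have g: "(\<delta> - s ^ k) ^ q \<in> idl.span ?Zq"
      unfolding mnr_scalar by (rule power_mem_span_powers[OF prime_mpoly])
    have "\<delta> ^ q = ((\<delta> - s ^ k) + s ^ k) ^ q" by simp
    also have "\<dots> = (\<delta> - s ^ k) ^ q + s ^ (k * q)"
      unfolding freshmans_dream'[OF prime_mpoly] by (simp add: power_mult)
    finally have "\<delta> ^ q - s ^ (k * q) \<in> idl.span ?Zq" using g by simp
    from prod_diff_mem_span[of "{..<t * r}" "\<lambda>_. \<delta> ^ q" "\<lambda>_. s ^ (k * q)", OF this]
    show ?thesis by simp
  qed
  ultimately have "(\<delta> ^ q) ^ (t * r) * F - ((\<delta> ^ q) ^ (t * r) - (s ^ (k * q)) ^ (t * r)) * F \<in> idl.span ?Zq"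
    by (rule idl.span_diff[OF _ span_mult_right])
  then have sF: "s ^ (k * q * (t * r)) * F \<in> idl.span ?Zq"
    by (simp add: left_diff_distrib power_mult)
  have "F - G \<in> idl.span {s}"
    unfolding F_def G_def
    by (intro prod_diff_mem_span mnr_diff_mem_span) (auto simp: x_def intro: idl.span_base idl.span_zero)
  then obtain b where b: "F - G = b * s" by (auto simp: idl.span_singleton)
  \<comment> \<open>A monomial of G is free of s, so it survives in F = G + b s. Multiplying by s^K
    changes only its exponent at (m, n), which the membership criterion does not test.\<close>
  have "G \<in> idl.span ?Zq"
    unfolding mem_span_var_powers_iff
  proof
    fix \<mu> assume \<mu>: "\<mu> \<in> Poly_Mapping.keys G"
    have "\<forall>\<mu>\<in>Poly_Mapping.keys G. Poly_Mapping.lookup \<mu> (m, n) = 0"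
      unfolding G_def using lookup_keys_mnr_var rg by (intro lookup_keys_prod_eq_0) blast
    with \<mu> have \<mu>0: "Poly_Mapping.lookup \<mu> (m, n) = 0" by blast
    have "\<mu> \<notin> Poly_Mapping.keys (b * s)"
    proof
      assume "\<mu> \<in> Poly_Mapping.keys (b * s)"
      then obtain u v where "\<mu> = u + v" "v \<in> Poly_Mapping.keys s" using keys_mult[of b s] by blast
      with \<mu>0 show False by (auto simp: s_def var_def lookup_add split: if_splits)
    qed
    moreover have "F = G + b * s" using b by (simp add: algebra_simps)
    ultimately have "Poly_Mapping.lookup F \<mu> \<noteq> 0"
      using \<mu> by (simp add: lookup_add in_keys_iff)
    define K where "K = k * q * (t * r)"
    have "Poly_Mapping.single (m, n) K + \<mu> \<in> Poly_Mapping.keys (s ^ K * F)"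
      using \<open>Poly_Mapping.lookup F \<mu> \<noteq> 0\<close>
      by (simp add: in_keys_iff s_def var_power lookup_single_mult)
    with sF obtain i j where ij: "i < m" "j < n"
      "q \<le> Poly_Mapping.lookup (Poly_Mapping.single (m, n) K + \<mu>) (i, j)"
      unfolding mem_span_var_powers_iff K_def by blast
    then have "q \<le> Poly_Mapping.lookup \<mu> (i, j)" by (auto simp: lookup_add lookup_single when_def)
    then show "\<exists>i<m. \<exists>j<n. q \<le> Poly_Mapping.lookup \<mu> (i, j)" using ij by blast
  qed
  then show ?thesis unfolding G_def .
qed

section \<open>Bounds for \<open>\<nu>\<close> and the limit\<close>

lemma mnr_permute_rows:
  assumes "\<rho> permutes {..<t}"
  shows "mnr x t (\<alpha> \<circ> \<rho>) \<gamma> = of_int (sign \<rho>) * mnr x t \<alpha> \<gamma>"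
proof -
  have "\<rho> permutes {0..<t}" using assms by (simp add: atLeast0LessThan)
  moreover have "Matrix.mat t t (\<lambda>(i, j). x ((\<alpha> \<circ> \<rho>) i) (\<gamma> j)) =
      Matrix.mat t t (\<lambda>(i, j). Matrix.mat t t (\<lambda>(i, j). x (\<alpha> i) (\<gamma> j)) $$ (\<rho> i, j))"
    using permutes_in_image[OF assms] by (intro eq_matI) auto
  ultimately show ?thesis
    unfolding mnr_def by (simp add: det_permute_rows[of "Matrix.mat t t (\<lambda>(i, j). x (\<alpha> i) (\<gamma> j))"])
qed

lemma mnr_transpose: "mnr (\<lambda>i j. x j i) t \<gamma> \<alpha> = mnr x t \<alpha> \<gamma>"
proof -
  have "Matrix.mat t t (\<lambda>(i, j). x (\<alpha> j) (\<gamma> i)) = transpose_mat (Matrix.mat t t (\<lambda>(i, j). x (\<alpha> i) (\<gamma> j)))"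
    by (intro eq_matI) auto
  then show ?thesis
    unfolding mnr_def by (simp add: Determinant.det_transpose[of _ t])
qed

lemma mnr_permute_cols:
  assumes "\<kappa> permutes {..<t}"
  shows "mnr x t \<alpha> (\<gamma> \<circ> \<kappa>) = of_int (sign \<kappa>) * mnr x t \<alpha> \<gamma>"
  using mnr_permute_rows[OF assms, of "\<lambda>i j. x j i" \<gamma> \<alpha>]
  by (simp only: mnr_transpose[of x t "\<gamma> \<circ> \<kappa>" \<alpha>] mnr_transpose[of x t \<gamma> \<alpha>])

text \<open>Here \<open>e\<close> lists the values of \<alpha> in increasing order, and \<rho> is
  the inverse of \<alpha> after \<open>e\<close>.\<close>

lemma inj_on_sort_permutation:
  fixes \<alpha> :: "nat \<Rightarrow> nat"
  assumes "inj_on \<alpha> {..<t}"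
  obtains \<rho> where "\<rho> permutes {..<t}" "strict_mono_on {..<t} (\<alpha> \<circ> \<rho>)"
proof -
  define e where "e i = sorted_list_of_set (\<alpha> ` {..<t}) ! i" for i
  have len: "length (sorted_list_of_set (\<alpha> ` {..<t})) = t"
    using assms by (simp add: card_image)
  have bij_e: "bij_betw e {..<t} (\<alpha> ` {..<t})"
    unfolding e_def by (rule bij_betw_nth) (use len in auto)
  have bij_\<alpha>: "bij_betw \<alpha> {..<t} (\<alpha> ` {..<t})" using assms by (simp add: bij_betw_def)
  define \<rho> where "\<rho> i = (if i < t then inv_into {..<t} \<alpha> (e i) else i)" for i
  have "bij_betw (inv_into {..<t} \<alpha> \<circ> e) {..<t} {..<t}"
    by (rule bij_betw_trans[OF bij_e bij_betw_inv_into[OF bij_\<alpha>]])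
  then have "bij_betw \<rho> {..<t} {..<t}"
    by (rule bij_betw_cong[THEN iffD1, rotated]) (auto simp: \<rho>_def)
  then have "\<rho> permutes {..<t}" by (rule bij_imp_permutes) (auto simp: \<rho>_def)
  moreover have "(\<alpha> \<circ> \<rho>) i = e i" if "i < t" for i
    using that bij_betwE[OF bij_e] by (simp add: \<rho>_def f_inv_into_f)
  then have "strict_mono_on {..<t} (\<alpha> \<circ> \<rho>)"
    using sorted_wrt_nth_less[OF sorted_list_of_set.strict_sorted_key_list_of_set[of "\<alpha> ` {..<t}"]] len
    by (auto simp: strict_mono_on_def e_def)
  ultimately show ?thesis by (rule that)
qed

text \<open>A non-injective choice of rows or columns gives 0; an injective one can be sorted at the
  cost of a sign, which is its own inverse.\<close>

lemma minors_ideal_eq_span: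
  "(minors_ideal m n t :: 'a::comm_ring_1 mpoly set) = idl.span (mnrs var m n t)"
proof
  show "minors_ideal m n t \<subseteq> idl.span (mnrs var m n t :: 'a mpoly set)"
    unfolding minors_ideal_def gen_ideal_eq_span
    by (rule idl.span_mono) (auto simp: minor_eq_mnr intro!: mnr_mem_mnrs)
  let ?S = "{minor t rs cs | rs cs.
      strict_mono_on {..<t} rs \<and> rs ` {..<t} \<subseteq> {..<m} \<and>
      strict_mono_on {..<t} cs \<and> cs ` {..<t} \<subseteq> {..<n}} :: 'a mpoly set"
  have "f \<in> idl.span ?S" if f: "f \<in> mnrs var m n t" for f :: "'a mpoly"
  proof -
    from f obtain \<alpha> \<gamma> where f: "\<alpha> \<in> {..<t} \<rightarrow> {..<m}" "\<gamma> \<in> {..<t} \<rightarrow> {..<n}" "f = mnr var t \<alpha> \<gamma>"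
      by (auto simp: mnrs_def)
    show ?thesis
    proof (cases "inj_on \<alpha> {..<t} \<and> inj_on \<gamma> {..<t}")
      case False
      then show ?thesis 
        using mnr_eq_0_if_not_inj[of \<alpha> t "var :: nat \<Rightarrow> nat \<Rightarrow> 'a mpoly" \<gamma>]
          mnr_eq_0_if_not_inj[of \<gamma> t "\<lambda>i j. var j i :: 'a mpoly" \<alpha>]
        by (auto simp: f(3) mnr_transpose[of "var :: nat \<Rightarrow> nat \<Rightarrow> 'a mpoly" t \<gamma> \<alpha>] idl.span_zero)
    next
      case True
      obtain \<rho> where \<rho>: "\<rho> permutes {..<t}" "strict_mono_on {..<t} (\<alpha> \<circ> \<rho>)"
        using inj_on_sort_permutation True by blast
      obtain \<kappa> where \<kappa>: "\<kappa> permutes {..<t}" "strict_mono_on {..<t} (\<gamma> \<circ> \<kappa>)"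
        using inj_on_sort_permutation True by blast
      have "minor t (\<alpha> \<circ> \<rho>) (\<gamma> \<circ> \<kappa>) = of_int (sign \<kappa>) * (of_int (sign \<rho>) * f)"
        unfolding minor_eq_mnr f(3) mnr_permute_rows[OF \<rho>(1)] mnr_permute_cols[OF \<kappa>(1)] ..
      then have "f = of_int (sign \<rho>) * (of_int (sign \<kappa>) * minor t (\<alpha> \<circ> \<rho>) (\<gamma> \<circ> \<kappa>))"
        by (simp add: sign_def)
      moreover have "minor t (\<alpha> \<circ> \<rho>) (\<gamma> \<circ> \<kappa>) \<in> ?S"
      proof -
        have "(\<alpha> \<circ> \<rho>) ` {..<t} \<subseteq> {..<m}" "(\<gamma> \<circ> \<kappa>) ` {..<t} \<subseteq> {..<n}"
          unfolding image_comp[symmetric] permutes_image[OF \<rho>(1)] permutes_image[OF \<kappa>(1)]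
          using f(1,2) by auto
        with \<rho>(2) \<kappa>(2) show ?thesis by blast
      qed
      ultimately show ?thesis by (simp add: span_mult_left idl.span_base)
    qed
  qed
  then have "mnrs var m n t \<subseteq> idl.span ?S" by (rule subsetI)
  then show "idl.span (mnrs var m n t) \<subseteq> (minors_ideal m n t :: 'a mpoly set)"
    unfolding minors_ideal_def gen_ideal_eq_span span_subset_iff .
qed

lemma ideal_pow_span: "ideal_pow (idl.span S) r = idl.span (S ^ r)"
proof -
  have *: "{prod_list xs |xs. length xs = r \<and> set xs \<subseteq> A} = A ^ r" for A :: "'a set"
    by (auto simp: set_power_iff_prod_list)
  show ?thesis
    unfolding ideal_pow_def gen_ideal_eq_span * idl.span_eq
    using set_power_subset_span[of "idl.span S" S r] idl.span_superset[of "idl.span S ^ r"]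
      set_power_mono[OF idl.span_superset, of S r] by auto
qed

lemma ideal_pow_minors_subset:
  assumes p: "prime CHAR('a::comm_ring_1)" "q = CHAR('a) ^ e"
    and "k < t" "t \<le> m" "t \<le> n" and r: "(m - k) * (n - k) * (q - 1) < (t - k) * r"
  shows "ideal_pow (minors_ideal m n t) r \<subseteq> frob_pow (max_ideal m n :: 'a mpoly set) q"
  unfolding minors_ideal_eq_span ideal_pow_span frob_pow_max_ideal[OF p] span_subset_iff
proof
  fix f :: "'a mpoly" assume "f \<in> mnrs var m n t ^ r"
  then obtain xs where xs: "length xs = r" "set xs \<subseteq> mnrs var m n t" "f = prod_list xs"
    by (auto simp: set_power_iff_prod_list)
  have "\<exists>\<alpha> \<gamma>. \<alpha> \<in> {..<t} \<rightarrow> {..<m} \<and> \<gamma> \<in> {..<t} \<rightarrow> {..<n} \<and> xs ! l = mnr var t \<alpha> \<gamma>" if "l < r" for l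
  proof -
    have "xs ! l \<in> mnrs var m n t" using that xs(1,2) nth_mem by blast
    then show ?thesis unfolding mnrs_def by blast
  qed
  then obtain \<alpha> \<gamma> where *: "\<And>l. l < r \<Longrightarrow> \<alpha> l \<in> {..<t} \<rightarrow> {..<m}"
    "\<And>l. l < r \<Longrightarrow> \<gamma> l \<in> {..<t} \<rightarrow> {..<n}" "\<And>l. l < r \<Longrightarrow> xs ! l = mnr var t (\<alpha> l) (\<gamma> l)"
    by metis
  have "f = (\<Prod>l<r. xs ! l)"
    unfolding xs(3) prod.list_conv_set_nth xs(1) atLeast0LessThan ..
  also have "\<dots> = (\<Prod>l<r. mnr var t (\<alpha> l) (\<gamma> l))" using *(3) by (intro prod.cong) auto
  also have "\<dots> \<in> idl.span ((\<lambda>y. y ^ q) ` vars m n)"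
    by (rule prod_minors_mem_span_powers[OF p \<open>k < t\<close> r *(1,2)]) (use assms in auto)
  finally show "f \<in> idl.span ((\<lambda>y. y ^ q) ` vars m n)" .
qed

text \<open>The leading monomial of the K-th power has coefficient 1 and exponent K < q in every
  entry of the matrix.\<close>

lemma diag_prod_power_not_mem:
  assumes p: "prime CHAR('a::comm_ring_1)" "q = CHAR('a) ^ e" and "K < q"
  shows "(diag_prod m n :: 'a mpoly) ^ K \<notin> frob_pow (max_ideal m n) q"
proof
  assume "(diag_prod m n :: 'a mpoly) ^ K \<in> frob_pow (max_ideal m n) q"
  then have mem: "\<And>\<mu>. \<mu> \<in> Poly_Mapping.keys ((diag_prod m n :: 'a mpoly) ^ K) \<Longrightarrow>
      \<exists>i<m. \<exists>j<n. q \<le> Poly_Mapping.lookup \<mu> (i, j)"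
    unfolding frob_pow_max_ideal[OF p] mem_span_var_powers_iff by blast
  define M where "M = (\<Sum>p\<in>{..<m} \<times> {..<n}. Poly_Mapping.single p (1::nat))"
  have "has_lead ((diag_prod m n :: 'a mpoly) ^ K) (\<Sum>l<K. M)"
    using has_lead_prod[of "{..<K}" "\<lambda>_. diag_prod m n :: 'a mpoly" "\<lambda>_. M"] has_lead_diag_prod[of m n]
    by (simp add: M_def)
  then have "Poly_Mapping.lookup ((diag_prod m n :: 'a mpoly) ^ K) (\<Sum>l<K. M) = 1"
    by (rule has_lead_lookup)
  then have "(\<Sum>l<K. M) \<in> Poly_Mapping.keys ((diag_prod m n :: 'a mpoly) ^ K)"
    by (simp add: in_keys_iff)
  from mem[OF this] obtain i j where ij: "i < m" "j < n" "q \<le> Poly_Mapping.lookup (\<Sum>l<K. M) (i, j)"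
    by blast
  have "Poly_Mapping.lookup M (i, j) = 1"
    using ij(1,2) by (simp add: M_def lookup_sum lookup_single when_def sum.delta)
  moreover have "Poly_Mapping.lookup (\<Sum>l<K. M) (i, j) = (\<Sum>l<K. Poly_Mapping.lookup M (i, j))"
    by (rule lookup_sum)
  ultimately show False using ij(3) \<open>K < q\<close> by simp
qed

theorem theorem1p1:
  fixes m n t p :: nat
  assumes "0 < t" "t \<le> m" "m \<le> n"
    and "prime p" "CHAR('a::field) = p"
  shows "(\<lambda>e. real (nu m n (minors_ideal m n t :: 'a mpoly set) (p ^ e)) / real (p ^ e))
           \<longlonglongrightarrow> Min ((\<lambda>k. real ((m - k) * (n - k)) / real (t - k)) ` {..<t})"
proof -
  define c where "c k = real ((m - k) * (n - k)) / real (t - k)" for k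
  define lam where "lam = Min (c ` {..<t})"
  \<comment> \<open>Every t - k with k < t divides t!, so N times the minimum is the natural number
    \<open>s\<close>.\<close>
  define N :: nat where "N = fact t"
  define s where "s = Min ((\<lambda>k. N div (t - k) * ((m - k) * (n - k))) ` {..<t})"
  let ?I = "minors_ideal m n t :: 'a mpoly set"
  let ?m = "max_ideal m n :: 'a mpoly set"
  have pr: "prime CHAR('a)" using assms by simp
  have N: "N > 0" by (simp add: N_def)
  have ne: "{..<t} \<noteq> {}" using assms(1) by (simp add: lessThan_empty_iff)
  have dvd: "(t - k) dvd N" if "k < t" for k
    unfolding N_def using that by (intro dvd_fact) auto
  have c_eq: "real (N div (t - k) * ((m - k) * (n - k))) = real N * c k" if "k < t" for k
    using dvd[OF that] by (simp add: c_def real_of_nat_div)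
  have s_eq: "real s = real N * lam"
  proof -
    have "s \<in> (\<lambda>k. N div (t - k) * ((m - k) * (n - k))) ` {..<t}"
      unfolding s_def using ne by (intro Min_in) auto
    then obtain k where k: "k < t" "s = N div (t - k) * ((m - k) * (n - k))" by auto
    have "lam \<in> c ` {..<t}" unfolding lam_def using ne by (intro Min_in) auto
    then obtain k' where k': "k' < t" "lam = c k'" by auto
    have "lam \<le> c k" unfolding lam_def using k(1) by (intro Min_le) auto
    then have "real N * lam \<le> real s" unfolding k(2) c_eq[OF k(1)] by (intro mult_left_mono) auto
    moreover have "s \<le> N div (t - k') * ((m - k') * (n - k'))"
      unfolding s_def using k'(1) by (intro Min_le) auto
    then have "real s \<le> real N * lam" unfolding k'(2) c_eq[OF k'(1), symmetric] by (simp only: of_nat_le_iff)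
    ultimately show ?thesis by simp
  qed
  have sk: "s * (t - k) \<le> N * ((m - k) * (n - k))" if "k < t" for k
  proof -
    have "s \<le> N div (t - k) * ((m - k) * (n - k))"
      unfolding s_def using that by (intro Min_le) auto
    then have "s * (t - k) \<le> N div (t - k) * ((m - k) * (n - k)) * (t - k)" by (rule mult_le_mono1)
    also have "\<dots> = (N div (t - k) * (t - k)) * ((m - k) * (n - k))" by (simp add: mult_ac)
    also have "\<dots> = N * ((m - k) * (n - k))" using dvd[OF that] by simp
    finally show ?thesis .
  qed
  obtain h where h: "\<And>l. (diag_prod m n :: 'a mpoly) ^ (N * (l + h)) \<in> idl.span (mnrs var m n t ^ (s * l))"
    by (rule diag_prod_power_asymp[OF assms(1) sk]) auto
  have upper: "real r \<le> lam * real (p ^ e)" if "\<not> ideal_pow ?I r \<subseteq> frob_pow ?m (p ^ e)" for r e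
  proof -
    have "lam \<in> c ` {..<t}" unfolding lam_def using ne by (intro Min_in) auto
    then obtain k where k: "k < t" "lam = c k" by auto
    have "\<not> (m - k) * (n - k) * (p ^ e - 1) < (t - k) * r"
      using that ideal_pow_minors_subset[OF pr, of "p ^ e" e k t m n r] k(1) assms by auto
    then have "(t - k) * r \<le> (m - k) * (n - k) * (p ^ e - 1)" by simp
    also have "\<dots> \<le> (m - k) * (n - k) * p ^ e" by (intro mult_le_mono2) simp
    finally have "real ((t - k) * r) \<le> real ((m - k) * (n - k) * p ^ e)" by (rule of_nat_mono)
    then show ?thesis unfolding k(2) c_def using k(1) by (simp add: field_simps)
  qed
  have lower: "\<not> ideal_pow ?I (s * l) \<subseteq> frob_pow ?m (p ^ e)" if "N * (l + h) < p ^ e" for l e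
    using h[of l] diag_prod_power_not_mem[OF pr _ that, of e m n] assms(5)
    unfolding minors_ideal_eq_span ideal_pow_span by blast
  \<comment> \<open>A natural number bound is required for \<open>GREATEST\<close> to be
    meaningful.\<close>
  have bound: "r \<le> nat \<lfloor>lam * real (p ^ e)\<rfloor>" if "\<not> ideal_pow ?I r \<subseteq> frob_pow ?m (p ^ e)" for r e
    using upper[OF that] by (rule le_nat_floor)
  have nu_le: "real (nu m n ?I (p ^ e)) \<le> lam * real (p ^ e)" if "N * h < p ^ e" for e
  proof (rule upper)
    show "\<not> ideal_pow ?I (nu m n ?I (p ^ e)) \<subseteq> frob_pow ?m (p ^ e)"
      unfolding nu_def
    proof (rule GreatestI_nat[where P = "\<lambda>r. \<not> ideal_pow ?I r \<subseteq> frob_pow ?m (p ^ e)"])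
      \<comment> \<open>The exponent 0 witnesses that the set of admissible r is nonempty; it is the
        case l = 0 of \<open>lower\<close>, whence the condition N * h < p^e.\<close>
      show "\<not> ideal_pow ?I (s * 0) \<subseteq> frob_pow ?m (p ^ e)"
        by (rule lower) (use that in simp)
    qed (rule bound)
  qed
  have nu_ge: "real s * ((real (p ^ e) - 1) / real N - 1 - real h) \<le> real (nu m n ?I (p ^ e))"
    if big: "N * h < p ^ e" for e
  proof -
    \<comment> \<open>The largest l with N * (l + h) < p^e. Rounding costs at most 1 and the
      asymptotic loss costs h, both independent of e.\<close>
    define l where "l = (p ^ e - 1) div N - h"
    have "h \<le> (p ^ e - 1) div N" using big N by (simp add: less_eq_div_iff_mult_less_eq mult.commute)
    then have l: "l + h = (p ^ e - 1) div N" by (simp add: l_def)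
    have "N * (l + h) \<le> p ^ e - 1" unfolding l by simp
    then have "N * (l + h) < p ^ e" using big by linarith
    then have "s * l \<le> nu m n ?I (p ^ e)"
      unfolding nu_def
      by (rule Greatest_le_nat[where P = "\<lambda>r. \<not> ideal_pow ?I r \<subseteq> frob_pow ?m (p ^ e)", OF lower bound])
    moreover have "(real (p ^ e) - 1) / real N - 1 - real h \<le> real l"
    proof -
      have aux: "u - 1 - w \<le> v" if "u - 1 \<le> d" "v + w = d" for u v w d :: real
        using that by linarith
      have "real (p ^ e - 1) / real N - 1 \<le> real ((p ^ e - 1) div N)"
        using floor_divide_of_nat_eq[of "p ^ e - 1" N, where ?'a = real] by linarith
      moreover have "real l + real h = real ((p ^ e - 1) div N)" using l by (metis of_nat_add)
      ultimately have "real (p ^ e - 1) / real N - 1 - real h \<le> real l" by (rule aux)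
      moreover have "real (p ^ e - 1) = real (p ^ e) - 1" using big by (simp add: of_nat_diff)
      ultimately show ?thesis by (simp only:)
    qed
    ultimately have "real s * ((real (p ^ e) - 1) / real N - 1 - real h) \<le> real s * real l"
      by (intro mult_left_mono) auto
    also have "\<dots> \<le> real (nu m n ?I (p ^ e))"
      using \<open>s * l \<le> nu m n ?I (p ^ e)\<close> by (metis of_nat_le_iff of_nat_mult)
    finally show ?thesis .
  qed
  have p_inf: "filterlim (\<lambda>e. real (p ^ e)) at_top sequentially"
  proof (rule filterlim_at_top_mono[OF filterlim_real_sequentially always_eventually], rule allI)
    show "real e \<le> real (p ^ e)" for e
      using power_gt_expt[of p e] prime_gt_1_nat[OF assms(4)] by (intro of_nat_mono) simp
  qed
  have big: "eventually (\<lambda>e. N * h < p ^ e) sequentially"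
    using filterlim_at_top_dense[THEN iffD1, OF p_inf, rule_format, of "real (N * h)"]
    by (simp only: of_nat_less_iff)
  have "(\<lambda>e. real (nu m n ?I (p ^ e)) / real (p ^ e)) \<longlonglongrightarrow> lam"
  proof (rule real_tendsto_sandwich)
    \<comment> \<open>As s = N * lam, dividing the lower bound for \<nu> by p^e gives lam minus a
      constant over p^e.\<close>
    show "eventually (\<lambda>e. lam - real s * (1 / real N + 1 + real h) / real (p ^ e)
        \<le> real (nu m n ?I (p ^ e)) / real (p ^ e)) sequentially"
      using big
    proof eventually_elim
      case (elim e)
      have pe: "real (p ^ e) > 0" using elim by linarith
      have "lam - real s * (1 / real N + 1 + real h) / real (p ^ e) =
          real s * ((real (p ^ e) - 1) / real N - 1 - real h) / real (p ^ e)"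
        using pe N by (simp add: s_eq field_simps del: of_nat_power)
      also have "\<dots> \<le> real (nu m n ?I (p ^ e)) / real (p ^ e)"
        using nu_ge[OF elim] pe by (intro divide_right_mono) auto
      finally show ?case .
    qed
    show "eventually (\<lambda>e. real (nu m n ?I (p ^ e)) / real (p ^ e) \<le> lam) sequentially"
      using big
    proof eventually_elim
      case (elim e)
      have "real (p ^ e) > 0" using elim by linarith
      then show ?case using nu_le[OF elim] by (simp add: divide_le_eq del: of_nat_power)
    qed
    have "(\<lambda>e. real s * (1 / real N + 1 + real h) / real (p ^ e)) \<longlonglongrightarrow> 0"
      by (rule tendsto_divide_0[OF tendsto_const filterlim_at_top_imp_at_infinity[OF p_inf]])
    from tendsto_diff[OF tendsto_const[of lam] this]
    show "(\<lambda>e. lam - real s * (1 / real N + 1 + real h) / real (p ^ e)) \<longlonglongrightarrow> lam" by simp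
    show "(\<lambda>e. lam) \<longlonglongrightarrow> lam" by simp
  qed
  then show ?thesis unfolding lam_def c_def .
qed

end
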